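(* Let $n$ and $k$ be integers with $3\le k\le n-2$, and let $T$ be an $n$-vertex tree with exactly $k$ leaves. Then $\xi^d(T)\le\xi^d(P_{n-k}(\lfloor\frac k2\rfloor,\lceil\frac k2\rceil))$, with equality if and only if $T\cong P_{n-k}(\lfloor\frac k2\rfloor,\lceil\frac k2\rceil)$.
   Context: All graphs are simple and connected; a leaf is a vertex of degree 1. For a graph $G$ and vertices $u,v$, $d_G(u,v)$ is the distance; $D_G(v)=\sum_{u\in V_G}d_G(u,v)$; the eccentricity $\varepsilon_G(v)$ is the maximum distance from $v$ to any vertex. The eccentric distance sum is $\xi^d(G)=\sum_{v\in V_G}\varepsilon_G(v)D_G(v)$. For $l\ge 2$ and $a,b\ge1$, $P_l(a,b)$ is the tree obtained from the path $P_l=v_1\ldots v_l$ by attaching $a$ pendant vertices to $v_1$ and $b$ pendant vertices to $v_l$. *)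

theory Defs
  imports "Graph_Theory.Graph_Theory"
begin

text \<open>
  A simple graph is a finite, symmetric, loop-free pair digraph (locale \<^locale>\<open>pair_graph\<close>), so
  that an undirected edge is a pair of opposite arcs. The library's \<^const>\<open>tree\<close> is not usable
  for such graphs, since it counts the closed walk along an arc and back as a cycle; an undirected
  cycle is a \<^const>\<open>pre_digraph.cycle\<close> of length at least 3.
\<close>

definition tree_graph :: "'a pair_pre_digraph \<Rightarrow> bool" where
  "tree_graph G \<longleftrightarrow>
     pair_graph G \<and> connected G \<and> \<not> (\<exists>p. pre_digraph.cycle G p \<and> 3 \<le> length p)"

definition leaves :: "('a, 'b) pre_digraph \<Rightarrow> 'a set" where
  "leaves G = {v \<in> verts G. out_degree G v = 1}"

text \<open>Only meaningful when \<open>v\<close> is reachable from \<open>u\<close>: the infimum of the empty set of naturals is 0.\<close>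

definition graph_dist :: "('a, 'b) pre_digraph \<Rightarrow> 'a \<Rightarrow> 'a \<Rightarrow> nat" where
  "graph_dist G u v = (INF p \<in> {p. pre_digraph.awalk G u p v}. length p)"

definition dist_sum :: "('a, 'b) pre_digraph \<Rightarrow> 'a \<Rightarrow> nat" where
  "dist_sum G v = (\<Sum>u\<in>verts G. graph_dist G u v)"

definition eccentricity :: "('a, 'b) pre_digraph \<Rightarrow> 'a \<Rightarrow> nat" where
  "eccentricity G v = Max (graph_dist G v ` verts G)"

definition ecc_dist_sum :: "('a, 'b) pre_digraph \<Rightarrow> nat" where
  "ecc_dist_sum G = (\<Sum>v\<in>verts G. eccentricity G v * dist_sum G v)"

text \<open>
  \<open>P\<^sub>l(a,b)\<close>: the path \<open>Spine 1, \<dots>, Spine l\<close> with \<open>a\<close> pendant vertices at \<open>Spine 1\<close> and \<open>b\<close>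
  pendant vertices at \<open>Spine l\<close>, intended for \<open>l \<ge> 2\<close> and \<open>a, b \<ge> 1\<close>. The arcs below are
  closed under symmetry.
\<close>

datatype pl_vertex = Spine nat | PendantL nat | PendantR nat

definition path_pendant :: "nat \<Rightarrow> nat \<Rightarrow> nat \<Rightarrow> pl_vertex pair_pre_digraph" where
  "path_pendant l a b =
    \<lparr> pverts = Spine ` {1..l} \<union> PendantL ` {1..a} \<union> PendantR ` {1..b},
      parcs = ({(Spine i, Spine (i + 1)) | i. 1 \<le> i \<and> i < l}
             \<union> {(Spine 1, PendantL j) | j. j \<in> {1..a}}
             \<union> {(Spine l, PendantR j) | j. j \<in> {1..b}})\<^sup>s \<rparr>"

end

theory Submission
  imports Defs
begin

text \<open>
  Split the vertices into the \<open>k\<close> leaves and the \<open>l = n - k\<close> inner vertices and the sum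
  \<open>\<Sum>\<^sub>v \<epsilon>(v) D(v) = \<Sum>\<^sub>v \<Sum>\<^sub>u \<epsilon>(v) d(v,u)\<close> into four parts accordingly; each part is at most its
  value for \<open>P\<^sub>l(\<lfloor>k/2\<rfloor>,\<lceil>k/2\<rceil>)\<close>. Leaves have eccentricity at most \<open>l + 1\<close>. The distances between
  leaves are counted edge by edge: every inner edge separates at most \<open>\<lfloor>k/2\<rfloor>\<lceil>k/2\<rceil>\<close> pairs. For the
  parts weighted by eccentricities of inner vertices, start with the inner vertices of a diametral
  path, which already determines the eccentricities, and attach the remaining inner vertices one by
  one; each step increases the sum by less than extending the path would. Equality therefore forces
  the inner vertices to form a path, all leaves to have eccentricity \<open>l + 1\<close> and hence to hang at the
  two ends, and the ends to be balanced.
\<close>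

section \<open>Sums over a path\<close>

text \<open>The obstacle is that an eccentricity depends on the whole tree and would change if the
  tree were built up by induction. It is therefore frozen as a weight, and for vertices off the
  diametral path the growth argument uses only that it is at most the number of inner vertices on
  that path. This holds because an inner vertex has a neighbour leading away from any given vertex,
  so it cannot attain the diameter. A path with \<open>s + 1\<close> vertices has an end of weight
  \<open>s + 1\<close>, while a vertex attached to \<open>s\<close> others has weight at most
  \<open>s\<close>: this difference of one is the source of strictness.

  Three sums must grow together: attaching \<open>z\<close> at \<open>p\<close> changes the double
  sum by weighted distances from \<open>p\<close>, and passing from \<open>p\<close> to
  \<open>z\<close> changes those by the total weight.

  Acyclicity enters as two facts only: adjacent vertices are never equidistant from a vertex, and at
  most one neighbour is nearer to it. They determine all distances of an attached vertex and make
  distances along a path first fall and then rise.\<close>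

definition path_ecc_sum :: "nat \<Rightarrow> nat" where
  "path_ecc_sum l = (\<Sum>i = 1..l. max i (l + 1 - i))"

text \<open>In \<open>path_pendant l a b\<close> with \<open>a, b\<close> positive,
  \<open>Spine i\<close> has eccentricity \<open>max i (l + 1 - i)\<close> and distance
  \<open>i\<close> from a pendant vertex at \<open>Spine 1\<close>. So this is what one pendant
  vertex contributes to the terms of the spine vertices; by symmetry either end gives the same
  value.\<close>

definition path_end_sum :: "nat \<Rightarrow> nat" where
  "path_end_sum l = (\<Sum>i = 1..l. max i (l + 1 - i) * i)"

text \<open>Truncated subtraction makes one of the two summands vanish, so this is \<open>|i - j|\<close>.\<close>

definition gap :: "nat \<Rightarrow> nat \<Rightarrow> nat" where
  "gap i j = (i - j) + (j - i)"

definition path_inner_sum :: "nat \<Rightarrow> nat" where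
  "path_inner_sum l = (\<Sum>i = 1..l. max i (l + 1 - i) * (\<Sum>j = 1..l. gap i j))"

lemma sum_rev_Icc: "(\<Sum>i = 1..l. g (l + 1 - i)) = (\<Sum>i = 1..l. g i)"
  for g :: "nat \<Rightarrow> 'b :: comm_monoid_add"
  by (rule sum.reindex_bij_witness[of _ "\<lambda>i. l + 1 - i" "\<lambda>i. l + 1 - i"]) auto

lemma path_end_sum_rev: "(\<Sum>i = 1..l. max i (l + 1 - i) * (l + 1 - i)) = path_end_sum l"
proof -
  have "(\<Sum>i = 1..l. max i (l + 1 - i) * (l + 1 - i))
      = (\<Sum>i = 1..l. (\<lambda>j. max j (l + 1 - j) * j) (l + 1 - i))"
    by (rule sum.cong) (auto simp: max.commute)
  also have "\<dots> = path_end_sum l"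
    unfolding path_end_sum_def by (rule sum_rev_Icc)
  finally show ?thesis .
qed

text \<open>Lengthening the path lowers none of the old weights, and the new end has weight
  \<open>Suc s\<close>. The next three growth bounds use the same comparison.\<close>

lemma path_ecc_sum_Suc: "path_ecc_sum s + Suc s \<le> path_ecc_sum (Suc s)"
proof -
  have "path_ecc_sum s \<le> (\<Sum>i = 1..s. max i (Suc s + 1 - i))"
    unfolding path_ecc_sum_def by (rule sum_mono) auto
  then show ?thesis by (simp add: path_ecc_sum_def)
qed

lemma path_end_sum_Suc: "path_end_sum s + Suc s * Suc s \<le> path_end_sum (Suc s)"
proof -
  have "path_end_sum s \<le> (\<Sum>i = 1..s. max i (Suc s + 1 - i) * i)"
    unfolding path_end_sum_def by (rule sum_mono, rule mult_le_mono1) auto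
  then show ?thesis by (simp add: path_end_sum_def)
qed

text \<open>Read the longer path from its new end: the distances \<open>s + 1 - i\<close> all rise
  by one, and this rise sums to the total weight of the longer path.\<close>

lemma path_end_sum_Suc': "path_end_sum s + path_ecc_sum (Suc s) \<le> path_end_sum (Suc s)"
proof -
  have "path_end_sum s = (\<Sum>i = 1..s. max i (s + 1 - i) * (s + 1 - i))"
    by (simp only: path_end_sum_rev)
  also have "\<dots> \<le> (\<Sum>i = 1..s. max i (Suc s + 1 - i) * (s + 1 - i))"
    by (rule sum_mono, rule mult_le_mono1) auto
  also have "\<dots> = (\<Sum>i = 1..Suc s. max i (Suc s + 1 - i) * (s + 1 - i))"
    by simp
  finally have "path_end_sum s + path_ecc_sum (Suc s)
      \<le> (\<Sum>i = 1..Suc s. max i (Suc s + 1 - i) * (s + 1 - i) + max i (Suc s + 1 - i))"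
    by (simp add: path_ecc_sum_def sum.distrib)
  also have "\<dots> = (\<Sum>i = 1..Suc s. max i (Suc s + 1 - i) * (Suc s + 1 - i))"
    by (rule sum.cong) (auto simp: Suc_diff_le)
  finally show ?thesis by (simp only: path_end_sum_rev)
qed

lemma sum_gap_last: "(\<Sum>j = 1..s. gap (Suc s) j) = \<Sum>{1..s}"
proof -
  have "(\<Sum>j = 1..s. gap (Suc s) j) = (\<Sum>j = 1..s. (\<lambda>i. i) (s + 1 - j))"
    by (rule sum.cong) (auto simp: gap_def)
  then show ?thesis using sum_rev_Icc[of "\<lambda>i. i" s] by simp
qed

text \<open>The new vertex is as far from the old ones as a pendant vertex at the old end, which
  gives \<open>path_end_sum s\<close>; its own weight \<open>Suc s\<close> multiplies the distances
  1 to \<open>s\<close>.\<close>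

lemma path_inner_sum_Suc:
  "path_inner_sum s + path_end_sum s + Suc s * \<Sum>{1..s} \<le> path_inner_sum (Suc s)"
proof -
  have "path_inner_sum s + path_end_sum s
      = (\<Sum>i = 1..s. max i (s + 1 - i) * ((\<Sum>j = 1..s. gap i j) + (s + 1 - i)))"
    by (simp only: path_inner_sum_def path_end_sum_rev[symmetric] sum.distrib add_mult_distrib2)
  also have "\<dots> \<le> (\<Sum>i = 1..s. max i (Suc s + 1 - i) * (\<Sum>j = 1..Suc s. gap i j))"
    by (intro sum_mono mult_le_mono) (auto simp: gap_def)
  finally show ?thesis
    by (simp add: path_inner_sum_def sum_gap_last[unfolded One_nat_def] gap_def[of "Suc s" "Suc s"])
qed

section \<open>Tree metrics and growth by pendant vertices\<close>

text \<open>Distance in a finite connected simple graph satisfies all but the last two assumptions.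
  Those exclude odd and even cycles, respectively.\<close>

locale tree_metric =
  fixes V :: "'a set" and E :: "'a rel" and d :: "'a \<Rightarrow> 'a \<Rightarrow> nat"
  assumes finite_V: "finite V"
    and edge_V: "(u, v) \<in> E \<Longrightarrow> u \<in> V \<and> v \<in> V"
    and edge_sym: "(u, v) \<in> E \<Longrightarrow> (v, u) \<in> E"
    and d_sym: "\<lbrakk>u \<in> V; v \<in> V\<rbrakk> \<Longrightarrow> d u v = d v u"
    and d_eq_0: "\<lbrakk>u \<in> V; v \<in> V\<rbrakk> \<Longrightarrow> d u v = 0 \<longleftrightarrow> u = v"
    and d_edge_le: "\<lbrakk>(u, v) \<in> E; w \<in> V\<rbrakk> \<Longrightarrow> d u w \<le> Suc (d v w)"
    and nearer_nbr: "\<lbrakk>u \<in> V; w \<in> V; u \<noteq> w\<rbrakk> \<Longrightarrow> \<exists>v. (u, v) \<in> E \<and> d u w = Suc (d v w)"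
    and d_edge_ne: "\<lbrakk>(u, v) \<in> E; w \<in> V\<rbrakk> \<Longrightarrow> d u w \<noteq> d v w"
    and nearer_unique: "\<lbrakk>(a, b) \<in> E; (a, c) \<in> E; w \<in> V; d b w < d a w; d c w < d a w\<rbrakk> \<Longrightarrow> b = c"
begin

lemma d_self [simp]: "u \<in> V \<Longrightarrow> d u u = 0"
  by (simp add: d_eq_0)

lemma d_edge_cases:
  assumes "(u, v) \<in> E" "w \<in> V"
  obtains "d u w = Suc (d v w)" | "d v w = Suc (d u w)"
  using d_edge_le[OF assms] d_edge_le[OF edge_sym[OF assms(1)] assms(2)] d_edge_ne[OF assms]
  by linarith

lemma farther_nbr:
  assumes "(a, b) \<in> E" "(a, c) \<in> E" "b \<noteq> c" "w \<in> V" "d b w < d a w"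
  shows "d c w = Suc (d a w)"
  using assms nearer_unique[of a b c w] d_edge_cases[of a c w] by (metis lessI)

lemma d_edge: "(u, v) \<in> E \<Longrightarrow> d u v = 1"
  using d_edge_cases[of u v v] edge_V[of u v] d_self by (metis One_nat_def nat.distinct(1))

lemma d_triangle:
  assumes "u \<in> V" "v \<in> V" "w \<in> V"
  shows "d u w \<le> d u v + d v w"
  using assms(1)
proof (induction "d u v" arbitrary: u)
  case 0
  then show ?case using assms d_eq_0 by simp
next
  case (Suc m)
  then have "u \<noteq> v" using assms(2) by auto
  then obtain x where x: "(u, x) \<in> E" "d u v = Suc (d x v)"
    using nearer_nbr Suc.prems assms by blast
  then have "d x w \<le> d x v + d v w" using Suc edge_V by simp
  moreover have "d u w \<le> Suc (d x w)" using d_edge_le x assms by blast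
  ultimately show ?case using x by simp
qed

text \<open>These are the vertex sets of subtrees, and the empty set. Using the ambient
  \<open>d\<close> keeps distances unchanged while a subtree grows.\<close>

definition geo_closed :: "'a set \<Rightarrow> bool" where
  "geo_closed S \<longleftrightarrow> S \<subseteq> V \<and> (\<forall>u\<in>S. \<forall>w\<in>S. u \<noteq> w \<longrightarrow> (\<exists>v\<in>S. (u, v) \<in> E \<and> d u w = Suc (d v w)))"

lemma geo_closed_sub: "geo_closed S \<Longrightarrow> S \<subseteq> V"
  by (simp add: geo_closed_def)

lemma geo_closedE:
  assumes "geo_closed S" "u \<in> S" "w \<in> S" "u \<noteq> w"
  obtains v where "v \<in> S" "(u, v) \<in> E" "d u w = Suc (d v w)"
  using assms unfolding geo_closed_def by meson

lemma geo_closed_singleton: "s \<in> V \<Longrightarrow> geo_closed {s}"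
  by (simp add: geo_closed_def)

text \<open>Otherwise \<open>z\<close> would be the only neighbour of \<open>p\<close> nearer to
  \<open>w\<close>, and closure would put it into \<open>S\<close>.\<close>

lemma pendant_dist:
  assumes S: "geo_closed S" and "p \<in> S" "z \<notin> S" "(p, z) \<in> E" "w \<in> S"
  shows "d z w = Suc (d p w)"
proof (rule ccontr)
  assume *: "d z w \<noteq> Suc (d p w)"
  have w: "w \<in> V" using assms geo_closed_sub by blast
  have pz: "d p w = Suc (d z w)"
    using * d_edge_cases[OF \<open>(p, z) \<in> E\<close> w] by metis
  then have "p \<noteq> w" using w by auto
  then obtain v where v: "v \<in> S" "(p, v) \<in> E" "d p w = Suc (d v w)"
    using geo_closedE[OF S assms(2,5)] by blast
  have "v = z"
    by (rule nearer_unique[OF v(2) assms(4) w]) (use v pz in auto)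
  then show False using v assms(3) by simp
qed

lemma geo_closed_insert:
  assumes S: "geo_closed S" and "p \<in> S" "z \<notin> S" "(p, z) \<in> E"
  shows "geo_closed (insert z S)"
  unfolding geo_closed_def
proof (intro conjI ballI impI)
  have pV: "p \<in> V" "z \<in> V" and SV: "S \<subseteq> V" using assms edge_V geo_closed_sub by blast+
  then show "insert z S \<subseteq> V" by blast
  note pd = pendant_dist[OF assms]
  fix u w assume uw: "u \<in> insert z S" "w \<in> insert z S" "u \<noteq> w"
  show "\<exists>v\<in>insert z S. (u, v) \<in> E \<and> d u w = Suc (d v w)"
  proof (cases "u = z")
    case True
    then have "w \<in> S" using uw by auto
    then show ?thesis using True pd edge_sym assms by blast
  next
    case u: False
    show ?thesis
    proof (cases "w = z")
      case w: True
      have dz: "d x z = Suc (d x p)" if "x \<in> S" for x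
        using pd[OF that] d_sym[of x z] d_sym[of x p] pV SV that by auto
      show ?thesis
      proof (cases "u = p")
        case True
        then show ?thesis using w assms(4) dz[OF assms(2)] pV by auto
      next
        case False
        then obtain v where "v \<in> S" "(u, v) \<in> E" "d u p = Suc (d v p)"
          using geo_closedE[OF S] u uw assms(2) by blast
        then show ?thesis using w u uw dz by auto
      qed
    next
      case False
      then show ?thesis using u uw S by (auto simp: geo_closed_def)
    qed
  qed
qed

lemma geo_closed_induct [consumes 4, case_names base attach]:
  assumes I: "geo_closed I" and B: "geo_closed B" "B \<subseteq> I" "B \<noteq> {}"
    and base: "Q B"
    and attach: "\<And>S p z. \<lbrakk>geo_closed S; B \<subseteq> S; S \<subseteq> I; Q S; p \<in> S; z \<in> I - S;
        \<And>w. w \<in> S \<Longrightarrow> d z w = Suc (d p w)\<rbrakk> \<Longrightarrow> Q (insert z S)"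
  shows "Q I"
proof -
  have fin: "finite I" using finite_subset[OF geo_closed_sub[OF I] finite_V] .
  have step: "Q I" if "geo_closed S" "B \<subseteq> S" "S \<subseteq> I" "Q S" for S
    using that
  proof (induction "card (I - S)" arbitrary: S)
    case 0
    then have "I - S = {}" using fin by simp
    then show ?case using 0 by (metis Diff_eq_empty_iff subset_antisym)
  next
    case (Suc m)
    obtain s where s: "s \<in> S" using B Suc.prems by blast
    have ne: "I - S \<noteq> {}" using Suc.hyps(2) by force
    \<comment> \<open>A missing vertex nearest to \<open>s\<close>: its neighbour towards
      \<open>s\<close> stays in \<open>I\<close> because \<open>I\<close> is closed, and belongs to
      \<open>S\<close> because it is nearer still.\<close>
    then obtain z where z: "z \<in> I - S" "\<And>y. y \<in> I - S \<Longrightarrow> d z s \<le> d y s"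
      using arg_min_if_finite(1)[of "I - S" "\<lambda>z. d z s"] arg_min_least[of "I - S" _ "\<lambda>z. d z s"] fin
      by blast
    have "z \<noteq> s" "s \<in> I" using z s Suc.prems by auto
    then obtain p where p: "p \<in> I" "(z, p) \<in> E" "d z s = Suc (d p s)"
      using geo_closedE[OF I, of z s] z by blast
    then have pS: "p \<in> S" using z(2)[of p] by auto
    have zS: "z \<notin> S" using z by auto
    have pz: "(p, z) \<in> E" using edge_sym p by blast
    have Q: "Q (insert z S)"
      by (rule attach[OF Suc.prems pS z(1)]) (rule pendant_dist[OF Suc.prems(1) pS zS pz])
    have "I - insert z S = (I - S) - {z}" by blast
    then have m: "m = card (I - insert z S)"
      using Suc.hyps(2) z(1) fin by simp
    have sub: "B \<subseteq> insert z S" "insert z S \<subseteq> I"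
      using Suc.prems z(1) by auto
    show ?case
      by (rule Suc.hyps(1)[OF m geo_closed_insert[OF Suc.prems(1) pS zS pz] sub Q])
  qed
  show ?thesis
    by (rule step[OF B(1) subset_refl B(2) base])
qed

end

text \<open>The positions \<open>i\<close> and \<open>l + 1 - i\<close> carry equal weights, and
  their incremented distances from \<open>j\<close> add up to at most \<open>l + 1\<close>, with
  equality when \<open>j\<close> is an end. This serves as the base of the growth argument.\<close>

lemma path_vertex_sum_le:
  assumes "1 \<le> j" "j \<le> l"
  shows "(\<Sum>i = 1..l. max i (l + 1 - i) * Suc (gap j i)) \<le> path_end_sum l"
proof -
  let ?m = "\<lambda>i. max i (l + 1 - i)"
  have "(\<Sum>i = 1..l. ?m i * Suc (gap j i)) + (\<Sum>i = 1..l. ?m i * Suc (gap j i))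
      = (\<Sum>i = 1..l. ?m i * Suc (gap j i))
        + (\<Sum>i = 1..l. ?m (l + 1 - i) * Suc (gap j (l + 1 - i)))"
    by (simp only: sum_rev_Icc[of "\<lambda>i. ?m i * Suc (gap j i)"])
  also have "\<dots> = (\<Sum>i = 1..l. ?m i * (Suc (gap j i) + Suc (gap j (l + 1 - i))))"
    unfolding sum.distrib[symmetric] by (rule sum.cong) (auto simp: max.commute algebra_simps)
  also have "\<dots> \<le> (\<Sum>i = 1..l. ?m i * (i + (l + 1 - i)))"
    using assms by (intro sum_mono mult_le_mono2) (auto simp: gap_def)
  also have "\<dots> = path_end_sum l + path_end_sum l"
    by (simp only: add_mult_distrib2 sum.distrib path_end_sum_rev flip: path_end_sum_def)
  finally show ?thesis by simp
qed

text \<open>With \<open>c\<close> the larger half and \<open>t\<close> the shift from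
  \<open>a\<close> to the smaller half, the two products differ by \<open>t * (c - a)\<close>. As
  \<open>a + t \<le> c\<close>, this vanishes only for \<open>t = 0\<close>.\<close>

lemma balanced_product_aux:
  fixes a b k :: nat
  assumes "a + b = k" "a \<le> b"
  shows "a * b \<le> (k div 2) * ((k + 1) div 2)"
    and "a * b = (k div 2) * ((k + 1) div 2) \<Longrightarrow> a = k div 2"
proof -
  define c t where "c = (k + 1) div 2" and "t = k div 2 - a"
  have ct: "k div 2 = a + t" "b = c + t" "a + t \<le> c"
    using assms unfolding c_def t_def by linarith+
  have eq: "(k div 2) * ((k + 1) div 2) = a * c + t * c" "a * b = a * c + t * a"
    unfolding c_def[symmetric] ct(1) ct(2) by (simp_all add: algebra_simps)
  show "a * b \<le> (k div 2) * ((k + 1) div 2)"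
    unfolding eq using ct(3) by simp
  show "a = k div 2" if "a * b = (k div 2) * ((k + 1) div 2)"
  proof -
    have "a * c + t * a = a * c + t * c" using that unfolding eq by simp
    then show ?thesis using ct by auto
  qed
qed

lemma balanced_product_le:
  fixes a b k :: nat
  assumes "a + b = k"
  shows "a * b \<le> (k div 2) * ((k + 1) div 2)"
proof (cases "a \<le> b")
  case True
  then show ?thesis using balanced_product_aux(1)[of a b k] assms by blast
next
  case False
  then show ?thesis using balanced_product_aux(1)[of b a k] assms by (simp add: mult.commute)
qed

section \<open>Distance sums under attachment of pendant vertices\<close>

context tree_metric
begin

definition ecc :: "'a \<Rightarrow> nat" where
  "ecc v = Max (d v ` V)"

lemma d_le_ecc: "w \<in> V \<Longrightarrow> d v w \<le> ecc v"
  by (simp add: ecc_def finite_V)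

lemma ecc_leI: "\<lbrakk>v \<in> V; \<And>w. w \<in> V \<Longrightarrow> d v w \<le> m\<rbrakk> \<Longrightarrow> ecc v \<le> m"
  unfolding ecc_def using finite_V by (subst Max_le_iff) auto

lemma geo_closed_finite: "geo_closed S \<Longrightarrow> finite S"
  using finite_subset geo_closed_sub finite_V by blast

lemma attach_dist_sym:
  assumes "geo_closed S" "p \<in> S" "z \<in> V" "d z v = Suc (d p v)" "v \<in> S"
  shows "d v z = Suc (d v p)"
proof -
  have "v \<in> V" "p \<in> V" using assms geo_closed_sub by blast+
  then show ?thesis using assms d_sym by simp
qed

lemma dist_less_card:
  assumes S: "geo_closed S" and "u \<in> S" "w \<in> S"
  shows "d u w < card S"
proof -
  have u: "geo_closed {u}" "{u} \<subseteq> S" "{u} \<noteq> {}"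
    using assms geo_closed_sub[OF S] by (auto intro!: geo_closed_singleton)
  have "\<forall>v\<in>S. \<forall>w\<in>S. d v w < card S"
    using S u
  proof (induction rule: geo_closed_induct)
    case (attach S' p z)
    have "z \<in> V" using attach.hyps(5) geo_closed_sub[OF S] by blast
    then have sym: "d v z = Suc (d v p)" if "v \<in> S'" for v
      using attach_dist_sym attach.hyps that by blast
    show ?case
      using attach.hyps attach.IH sym geo_closed_finite[OF attach.hyps(1)] \<open>z \<in> V\<close>
      by (auto intro: less_SucI)
  qed (use u geo_closed_sub[OF S] in auto)
  then show ?thesis using assms by blast
qed

text \<open>The \<open>Suc\<close> turns these into the distances from a leaf hanging at
  \<open>u\<close>. A new vertex sees the distances of \<open>p\<close> raised by one; an old vertex
  gains one term, which \<open>dist_less_card\<close> controls.\<close>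

lemma sum_dist_le:
  assumes S: "geo_closed S" and "u \<in> S"
  shows "(\<Sum>w\<in>S. Suc (d u w)) \<le> \<Sum>{1..card S}"
proof -
  have u: "geo_closed {u}" "{u} \<subseteq> S" "{u} \<noteq> {}"
    using assms geo_closed_sub[OF S] by (auto intro!: geo_closed_singleton)
  have "\<forall>v\<in>S. (\<Sum>w\<in>S. Suc (d v w)) \<le> \<Sum>{1..card S}"
    using S u
  proof (induction rule: geo_closed_induct)
    case (attach S' p z)
    have zV: "z \<in> V" using attach.hyps(5) geo_closed_sub[OF S] by blast
    have fin: "finite S'" "z \<notin> S'" using attach.hyps geo_closed_finite by auto
    have "(\<Sum>w\<in>insert z S'. Suc (d v w)) \<le> \<Sum>{1..card S'} + Suc (card S')"
      if v: "v \<in> insert z S'" for v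
    proof (cases "v = z")
      case True
      have "(\<Sum>w\<in>S'. Suc (d z w)) = (\<Sum>w\<in>S'. Suc (d p w) + 1)"
        using attach.hyps(6) by simp
      then show ?thesis
        using True fin zV attach.IH attach.hyps(4) unfolding sum.distrib by simp
    next
      case False
      then have vS: "v \<in> S'" using v by simp
      have "d v z = Suc (d v p)"
        using attach_dist_sym[OF attach.hyps(1,4) zV attach.hyps(6)[OF vS] vS] .
      then show ?thesis
        using fin attach.IH vS dist_less_card[OF attach.hyps(1) vS attach.hyps(4)] by fastforce
    qed
    then show ?case using fin by simp
  qed (use u geo_closed_sub[OF S] in auto)
  then show ?thesis using assms by blast
qed

text \<open>
  For \<open>P\<close> a path the bounds are attained by the path on \<open>card S\<close> vertices. Attaching a vertex \<open>z\<close>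
  off \<open>P\<close> with \<open>f z \<le> card P\<close> increases the left-hand sides by no more than lengthening the path
  by one vertex increases the right-hand sides, and by strictly less in the last one.
\<close>

lemma weighted_growth:
  assumes I: "geo_closed I" and P: "geo_closed P" "P \<subseteq> I" "P \<noteq> {}"
    and f_le: "\<And>w. w \<in> I \<Longrightarrow> f w \<le> card P"
    and base1: "(\<Sum>w\<in>P. f w) \<le> path_ecc_sum (card P)"
    and base2: "\<And>u. u \<in> P \<Longrightarrow> (\<Sum>w\<in>P. f w * Suc (d u w)) \<le> path_end_sum (card P)"
    and base3: "(\<Sum>w\<in>P. f w * (\<Sum>u\<in>P. d w u)) \<le> path_inner_sum (card P)"
  shows "(\<forall>u\<in>I. (\<Sum>w\<in>I. f w * Suc (d u w)) \<le> path_end_sum (card I)) \<and>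
     (\<Sum>w\<in>I. f w * (\<Sum>u\<in>I. d w u)) \<le> path_inner_sum (card I) \<and>
     (P \<noteq> I \<longrightarrow> (\<Sum>w\<in>I. f w * (\<Sum>u\<in>I. d w u)) < path_inner_sum (card I))"
proof -
  let ?Q = "\<lambda>S. (\<Sum>w\<in>S. f w) \<le> path_ecc_sum (card S) \<and>
     (\<forall>u\<in>S. (\<Sum>w\<in>S. f w * Suc (d u w)) \<le> path_end_sum (card S)) \<and>
     (\<Sum>w\<in>S. f w * (\<Sum>u\<in>S. d w u)) \<le> path_inner_sum (card S) \<and>
     (P \<noteq> S \<longrightarrow> (\<Sum>w\<in>S. f w * (\<Sum>u\<in>S. d w u)) < path_inner_sum (card S))"
  have "?Q I"
    using I P
  proof (induction rule: geo_closed_induct)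
    case base
    then show ?case using base1 base2 base3 by simp
  next
    case (attach S p z)
    let ?s = "card S"
    note S = attach.hyps(1)
    have zV: "z \<in> V" using attach.hyps(5) geo_closed_sub[OF I] by blast
    have fin: "finite S" "z \<notin> S" using attach.hyps geo_closed_finite by auto
    have card: "card (insert z S) = Suc ?s" using fin by simp
    have fz: "f z \<le> ?s"
      using f_le[of z] attach.hyps(2,5) card_mono[OF fin(1), of P] by auto
    have dz: "d z w = Suc (d p w)" "d w z = Suc (d w p)" if "w \<in> S" for w
      using attach.hyps(6)[OF that]
        attach_dist_sym[OF S attach.hyps(4) zV attach.hyps(6)[OF that] that] by auto
    have IH1: "(\<Sum>w\<in>S. f w) \<le> path_ecc_sum ?s"
      and IH2: "\<And>u. u \<in> S \<Longrightarrow> (\<Sum>w\<in>S. f w * Suc (d u w)) \<le> path_end_sum ?s"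
      and IH3: "(\<Sum>w\<in>S. f w * (\<Sum>u\<in>S. d w u)) \<le> path_inner_sum ?s"
      using attach.IH by auto
    have 1: "(\<Sum>w\<in>insert z S. f w) \<le> path_ecc_sum (Suc ?s)"
      using fin IH1 fz path_ecc_sum_Suc[of ?s] by simp
    have 2: "(\<Sum>w\<in>insert z S. f w * Suc (d u w)) \<le> path_end_sum (Suc ?s)"
      if u: "u \<in> insert z S" for u
    proof (cases "u = z")
      case True
      \<comment> \<open>Every vertex of \<open>S\<close> is one farther from \<open>z\<close> than
        from \<open>p\<close>, so the total weight is added, which is the increment in
        \<open>path_end_sum_Suc'\<close>.\<close>
      have "(\<Sum>w\<in>S. f w * Suc (d z w)) = (\<Sum>w\<in>S. f w * Suc (d p w)) + (\<Sum>w\<in>S. f w)"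
        unfolding sum.distrib[symmetric] by (rule sum.cong) (auto simp: dz)
      then show ?thesis
        using fin True zV IH2[OF attach.hyps(4)] 1 path_end_sum_Suc'[of ?s] by simp
    next
      case False
      then have uS: "u \<in> S" using u by simp
      then have "f z * Suc (d u z) \<le> Suc ?s * Suc ?s"
        using dist_less_card[OF S uS attach.hyps(4)] fz dz[OF uS]
        by (intro mult_le_mono) auto
      then show ?thesis
        using fin IH2[OF uS] path_end_sum_Suc[of ?s] by simp
    qed
    have 3: "(\<Sum>w\<in>insert z S. f w * (\<Sum>u\<in>insert z S. d w u)) < path_inner_sum (Suc ?s)"
    proof -
      have a: "(\<Sum>w\<in>S. f w * d w z) \<le> path_end_sum ?s"
      proof -
        have "(\<Sum>w\<in>S. f w * d w z) = (\<Sum>w\<in>S. f w * Suc (d p w))"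
          using dz attach.hyps(4) geo_closed_sub[OF S] by (intro sum.cong) (auto intro: d_sym)
        then show ?thesis using IH2[OF attach.hyps(4)] by simp
      qed
      have "(\<Sum>u\<in>S. d z u) \<le> \<Sum>{1..?s}"
        using sum_dist_le[OF S attach.hyps(4)] dz by simp
      then have "f z * (\<Sum>u\<in>S. d z u) \<le> ?s * \<Sum>{1..?s}"
        using fz by (rule mult_le_mono[rotated])
      moreover have "0 < \<Sum>{1..?s}"
        using attach.hyps(4) fin member_le_sum[of 1 "{1..?s}" "\<lambda>i. i"] by (fastforce simp: Suc_le_eq card_gt_0_iff)
      \<comment> \<open>Strictness arises here: \<open>z\<close> has weight at most
        \<open>?s\<close>, but the end of the longer path has weight \<open>Suc ?s\<close>.\<close>
      ultimately have b: "f z * (\<Sum>u\<in>S. d z u) < Suc ?s * \<Sum>{1..?s}" by simp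
      have "(\<Sum>w\<in>insert z S. f w * (\<Sum>u\<in>insert z S. d w u))
        = f z * (\<Sum>u\<in>S. d z u) + ((\<Sum>w\<in>S. f w * d w z) + (\<Sum>w\<in>S. f w * (\<Sum>u\<in>S. d w u)))"
        using fin zV by (simp add: sum.distrib[symmetric] add_mult_distrib2)
      then show ?thesis using a b IH3 path_inner_sum_Suc[of ?s] by linarith
    qed
    show ?case unfolding card using 1 2 3 by (meson order_less_imp_le)
  qed
  then show ?thesis by blast
qed

text \<open>
  Contracting a pendant vertex \<open>z\<close> into its neighbour changes the sum by twice the number of pairs
  separated by that edge, which is at most \<open>(k div 2) * ((k + 1) div 2)\<close>.
\<close>

lemma sum_dist_image_le:
  assumes S: "geo_closed S" and "finite L" "g ` L \<subseteq> S" "L \<noteq> {}"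
  shows "(\<Sum>u\<in>L. \<Sum>v\<in>L. d (g u) (g v))
      \<le> 2 * (card S - 1) * ((card L div 2) * ((card L + 1) div 2))"
proof -
  let ?q = "(card L div 2) * ((card L + 1) div 2)"
  obtain s where s: "s \<in> S" using assms by blast
  have s': "geo_closed {s}" "{s} \<subseteq> S" "{s} \<noteq> {}"
    using s geo_closed_sub[OF S] by (auto intro!: geo_closed_singleton)
  \<comment> \<open>All maps at once, because the induction hypothesis is applied to the contracted
    map \<open>h\<close>.\<close>
  have "\<forall>g. g ` L \<subseteq> S \<longrightarrow> (\<Sum>u\<in>L. \<Sum>v\<in>L. d (g u) (g v)) \<le> 2 * (card S - 1) * ?q"
    using S s'
  proof (induction rule: geo_closed_induct)
    case base
    show ?case
    proof (intro allI impI)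
      fix g :: "'b \<Rightarrow> 'a" assume "g ` L \<subseteq> {s}"
      then have "(\<Sum>u\<in>L. \<Sum>v\<in>L. d (g u) (g v)) = (\<Sum>u\<in>L. \<Sum>v\<in>L. 0)"
        using s geo_closed_sub[OF S] by (intro sum.cong refl) (auto simp: image_subset_iff)
      then show "(\<Sum>u\<in>L. \<Sum>v\<in>L. d (g u) (g v)) \<le> 2 * (card {s} - 1) * ?q" by simp
    qed
  next
    case (attach S' p z)
    have zV: "z \<in> V" using attach.hyps(5) geo_closed_sub[OF S] by blast
    have fin: "finite S'" "z \<notin> S'" using attach.hyps geo_closed_finite by auto
    show ?case
    proof (intro allI impI)
      fix g :: "'b \<Rightarrow> 'a" assume g: "g ` L \<subseteq> insert z S'"
      define h where "h u = (if g u = z then p else g u)" for u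
      define A where "A = {u\<in>L. g u = z}"
      have hS: "h ` L \<subseteq> S'" using g attach.hyps(4) by (auto simp: h_def)
      have A: "A \<subseteq> L" by (auto simp: A_def)
      have pV: "p \<in> V" using attach.hyps(4) geo_closed_sub[OF attach.hyps(1)] by blast
      have dist: "d (g u) (g v)
          = d (h u) (h v) + (of_bool (u \<in> A \<and> v \<notin> A) + of_bool (u \<notin> A \<and> v \<in> A))"
        if "u \<in> L" "v \<in> L" for u v
      proof -
        have *: "g u \<noteq> z \<Longrightarrow> d z (g u) = Suc (d p (g u)) \<and> d (g u) z = Suc (d (g u) p)"
          if "u \<in> L" for u
        proof -
          assume "g u \<noteq> z"
          then have "g u \<in> S'" using that g by blast
          then show ?thesis
            using attach.hyps(6) attach_dist_sym[OF attach.hyps(1,4) zV] by blast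
        qed
        show ?thesis
          using *[OF that(1)] *[OF that(2)] that zV pV
          by (auto simp: h_def A_def)
      qed
      have cross: "(\<Sum>u\<in>L. \<Sum>v\<in>L. of_bool (u \<in> X \<and> v \<in> Y)) = card X * card Y"
        if "X \<subseteq> L" "Y \<subseteq> L" for X Y
      proof -
        have "(\<Sum>u\<in>L. \<Sum>v\<in>L. of_bool (u \<in> X \<and> v \<in> Y) :: nat)
            = (\<Sum>u\<in>L. of_bool (u \<in> X) * (\<Sum>v\<in>L. of_bool (v \<in> Y)))"
          by (simp add: sum_distrib_left of_bool_conj)
        also have "\<dots> = card X * card Y"
          using that \<open>finite L\<close>
          by (simp add: sum_distrib_right[symmetric] sum.If_cases of_bool_def Int_absorb1)
        finally show ?thesis .
      qed
      have "(\<Sum>u\<in>L. \<Sum>v\<in>L. d (g u) (g v)) = (\<Sum>u\<in>L. \<Sum>v\<in>L. d (h u) (h v)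
          + (of_bool (u \<in> A \<and> v \<in> L - A) + of_bool (u \<in> L - A \<and> v \<in> A)))"
        by (intro sum.cong refl) (simp add: dist)
      also have "\<dots> = (\<Sum>u\<in>L. \<Sum>v\<in>L. d (h u) (h v)) + 2 * (card A * card (L - A))"
        using cross[of A "L - A"] cross[of "L - A" A] A
        by (simp only: sum.distrib) (simp add: mult.commute)
      also have "\<dots> \<le> 2 * (card S' - 1) * ?q + 2 * ?q"
      proof -
        have "card A + card (L - A) = card L"
          using A \<open>finite L\<close> by (metis card_Un_disjoint Diff_disjoint Diff_partition finite_Diff finite_subset)
        then have "card A * card (L - A) \<le> ?q" by (rule balanced_product_le)
        moreover have "(\<Sum>u\<in>L. \<Sum>v\<in>L. d (h u) (h v)) \<le> 2 * (card S' - 1) * ?q"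
          using attach.IH hS by blast
        ultimately show ?thesis by simp
      qed
      also have "\<dots> = 2 * (card (insert z S') - 1) * ?q"
      proof -
        have "0 < card S'" using fin attach.hyps(4) by (auto simp: card_gt_0_iff)
        then have "card (insert z S') - 1 = card S' - 1 + 1" using fin by simp
        then show ?thesis by (simp only: add_mult_distrib add_mult_distrib2 mult_1_right)
      qed
      finally show "(\<Sum>u\<in>L. \<Sum>v\<in>L. d (g u) (g v)) \<le> 2 * (card (insert z S') - 1) * ?q" .
    qed
  qed
  then show ?thesis using assms by blast
qed

end

section \<open>Leaves and diametral paths\<close>

text \<open>
  The value at \<open>P\<^sub>l(a,b)\<close> with \<open>a + b = k\<close> balanced. The first summand collects the leaves, which
  all have eccentricity \<open>l + 1\<close>: distances to leaves and to inner vertices. The other two collect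
  the distances from inner vertices to leaves and to inner vertices.
\<close>

definition broom_value :: "nat \<Rightarrow> nat \<Rightarrow> nat" where
  "broom_value l k = (l + 1) * (2 * (k * (k - 1)) + 2 * (l - 1) * ((k div 2) * ((k + 1) div 2))
     + k * \<Sum>{1..l}) + k * path_end_sum l + path_inner_sum l"

context tree_metric
begin

definition lvs :: "'a set" where
  "lvs = {v \<in> V. card (E `` {v}) = 1}"

definition inner :: "'a set" where
  "inner = V - lvs"

definition nbr :: "'a \<Rightarrow> 'a" where
  "nbr v = (THE w. (v, w) \<in> E)"

lemma innerI:
  assumes "(v, b) \<in> E" "(v, c) \<in> E" "b \<noteq> c"
  shows "v \<in> inner"
proof -
  have "E `` {v} \<noteq> {w}" for w using assms by (metis Image_singleton_iff singletonD)
  then show ?thesis using assms(1) edge_V by (auto simp: inner_def lvs_def card_1_singleton_iff)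
qed

lemma inner_two_nbrs:
  assumes "v \<in> inner" "w \<in> V" "w \<noteq> v"
  obtains b c where "(v, b) \<in> E" "(v, c) \<in> E" "b \<noteq> c"
proof -
  have "v \<in> V" using assms by (simp add: inner_def)
  then obtain b where b: "(v, b) \<in> E" using nearer_nbr assms by blast
  have "E `` {v} \<noteq> {b}" using assms(1) by (auto simp: inner_def lvs_def)
  then obtain c where "(v, c) \<in> E" "b \<noteq> c" using b by blast
  then show ?thesis using b that by blast
qed

lemma nbrs_leaf:
  assumes "v \<in> lvs"
  shows "E `` {v} = {nbr v}"
proof -
  obtain w where w: "E `` {v} = {w}" using assms by (auto simp: lvs_def card_1_singleton_iff)
  then have "nbr v = w" unfolding nbr_def by blast
  then show ?thesis using w by simp
qed

lemma d_leaf: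
  assumes "v \<in> lvs" "w \<in> V" "w \<noteq> v"
  shows "d v w = Suc (d (nbr v) w)"
proof -
  have "v \<in> V" using assms by (simp add: lvs_def)
  then obtain y where y: "(v, y) \<in> E" "d v w = Suc (d y w)"
    using nearer_nbr assms by metis
  then have "y = nbr v" using nbrs_leaf[OF assms(1)] by (metis Image_singleton_iff singletonD)
  then show ?thesis using y by simp
qed

text \<open>Two adjacent leaves would each be one step farther than the other from any third
  vertex.\<close>

lemma nbr_inner:
  assumes v: "v \<in> lvs" and "inner \<noteq> {}"
  shows "nbr v \<in> inner"
proof (rule ccontr)
  assume "nbr v \<notin> inner"
  have edge: "(v, nbr v) \<in> E" using nbrs_leaf[OF v] by blast
  then have "nbr v \<in> lvs" using \<open>nbr v \<notin> inner\<close> edge_V by (auto simp: inner_def)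
  then have "nbr (nbr v) = v" 
    using nbrs_leaf[of "nbr v"] edge_sym[OF edge] by (metis Image_singleton_iff singletonD)
  moreover obtain s where s: "s \<in> inner" using assms by blast
  moreover have "s \<in> V" "s \<noteq> v" "s \<noteq> nbr v"
    using s v \<open>nbr v \<in> lvs\<close> by (auto simp: inner_def)
  ultimately show False using d_leaf[OF v, of s] d_leaf[OF \<open>nbr v \<in> lvs\<close>, of s] by simp
qed

text \<open>A vertex strictly between two others on a geodesic has a neighbour on either side, so it
  is no leaf.\<close>

lemma geo_closed_inner: "geo_closed inner"
  unfolding geo_closed_def
proof (intro conjI ballI impI)
  show "inner \<subseteq> V" by (auto simp: inner_def)
  fix u w assume uw: "u \<in> inner" "w \<in> inner" "u \<noteq> w"
  then have V: "u \<in> V" "w \<in> V" by (auto simp: inner_def)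
  then obtain v where v: "(u, v) \<in> E" "d u w = Suc (d v w)" using nearer_nbr uw by blast
  have "v \<in> inner"
  proof (cases "v = w")
    case False
    then obtain y where y: "(v, y) \<in> E" "d v w = Suc (d y w)"
      using nearer_nbr edge_V v V by blast
    then have "y \<noteq> u" using v by auto
    then show ?thesis using innerI[OF y(1) edge_sym[OF v(1)]] by blast
  qed (use uw in simp)
  then show "\<exists>v\<in>inner. (u, v) \<in> E \<and> d u w = Suc (d v w)" using v by blast
qed

lemma d_leaf_leaf:
  assumes "inner \<noteq> {}" and u: "u \<in> lvs" and v: "v \<in> lvs" and "u \<noteq> v"
  shows "d u v = d (nbr u) (nbr v) + 2"
proof -
  have in_V: "u \<in> V" "v \<in> V" "nbr u \<in> V" "nbr v \<in> V" "nbr u \<noteq> v"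
    using u v nbr_inner[OF u] nbr_inner[OF v] assms(1) by (auto simp: inner_def lvs_def)
  have "d u v = Suc (d (nbr u) v)" using d_leaf[OF u in_V(2)] assms(4) by simp
  also have "d (nbr u) v = d v (nbr u)" using in_V d_sym by blast
  also have "d v (nbr u) = Suc (d (nbr v) (nbr u))" using d_leaf[OF v in_V(3)] in_V(5) by blast
  also have "d (nbr v) (nbr u) = d (nbr u) (nbr v)" using in_V d_sym by blast
  finally show ?thesis by simp
qed

text \<open>The extra 2 of \<open>d_leaf_leaf\<close> is absent on the diagonal, where both
  distances vanish; hence the factor \<open>card lvs - 1\<close>.\<close>

lemma sum_leaf_leaf:
  assumes "inner \<noteq> {}"
  shows "(\<Sum>u\<in>lvs. \<Sum>v\<in>lvs. d u v)
      = 2 * (card lvs * (card lvs - 1)) + (\<Sum>u\<in>lvs. \<Sum>v\<in>lvs. d (nbr u) (nbr v))"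
proof -
  have fin: "finite lvs" using finite_V by (simp add: lvs_def)
  have "(\<Sum>v\<in>lvs. d u v) = 2 * (card lvs - 1) + (\<Sum>v\<in>lvs. d (nbr u) (nbr v))"
    if u: "u \<in> lvs" for u
  proof -
    have self: "d u u = 0" "d (nbr u) (nbr u) = 0"
      using u nbr_inner[OF u assms] by (auto simp: inner_def lvs_def)
    have "(\<Sum>v\<in>lvs. d u v) = (\<Sum>v\<in>lvs - {u}. d u v)"
      using fin u self by (simp add: sum.remove)
    also have "\<dots> = (\<Sum>v\<in>lvs - {u}. d (nbr u) (nbr v) + 2)"
      using d_leaf_leaf[OF assms u] by (intro sum.cong) auto
    also have "\<dots> = (\<Sum>v\<in>lvs - {u}. d (nbr u) (nbr v)) + 2 * (card lvs - 1)"
      using fin u by (simp only: sum.distrib sum_constant card_Diff_singleton) simp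
    also have "(\<Sum>v\<in>lvs - {u}. d (nbr u) (nbr v)) = (\<Sum>v\<in>lvs. d (nbr u) (nbr v))"
      using fin u self by (simp add: sum.remove[where x = u])
    finally show ?thesis by simp
  qed
  then show ?thesis by (simp add: sum.distrib)
qed

lemma geodesic_exists:
  assumes "u \<in> V" "w \<in> V"
  shows "\<exists>x. x 0 = u \<and> x (d u w) = w \<and> (\<forall>i < d u w. (x i, x (Suc i)) \<in> E)"
  using assms(1)
proof (induction "d u w" arbitrary: u)
  case 0
  then have "u = w" using d_eq_0[of u w] assms by simp
  then show ?case using assms by (intro exI[of _ "\<lambda>_. u"]) simp
next
  case (Suc m)
  then have "u \<noteq> w" using assms by auto
  then obtain v where v: "(u, v) \<in> E" "d u w = Suc (d v w)"
    using nearer_nbr Suc.prems assms by blast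
  then have "m = d v w" "v \<in> V" using Suc.hyps(2) edge_V by auto
  then obtain x where x: "x 0 = v" "x (d v w) = w" "\<forall>i < d v w. (x i, x (Suc i)) \<in> E"
    using Suc.hyps(1) by blast
  show ?case
    using x v by (intro exI[of _ "\<lambda>i. case i of 0 \<Rightarrow> u | Suc j \<Rightarrow> x j"]) (auto split: nat.split)
qed

end

text \<open>\<open>p\<close> is one less than the diameter and counts the inner vertices of the
  path. Thus \<open>x 1\<close> to \<open>x p\<close> match the spine of
  \<open>path_pendant p a b\<close>, and the indices \<open>0\<close> and \<open>Suc p\<close> are
  the places of its pendant vertices.\<close>

locale diametral_tree = tree_metric +
  fixes x :: "nat \<Rightarrow> 'a" and p :: nat
  assumes p_pos: "1 \<le> p"
    and x_edge: "i \<le> p \<Longrightarrow> (x i, x (Suc i)) \<in> E"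
    and x_ends: "d (x 0) (x (Suc p)) = Suc p"
    and diam: "\<lbrakk>u \<in> V; v \<in> V\<rbrakk> \<Longrightarrow> d u v \<le> Suc p"
begin

abbreviation spine :: "'a set" where
  "spine \<equiv> x ` {1..p}"

lemma x_V: "i \<le> Suc p \<Longrightarrow> x i \<in> V"
  using edge_V[OF x_edge[of i]] edge_V[OF x_edge[of "i - 1"]] by (cases "i \<le> p") (auto simp: le_Suc_eq)

lemma x_dist_le: "\<lbrakk>i \<le> j; j \<le> Suc p\<rbrakk> \<Longrightarrow> d (x i) (x j) \<le> j - i"
proof (induction j rule: dec_induct)
  case base
  then show ?case using x_V by simp
next
  case (step j)
  have "d (x i) (x (Suc j)) \<le> d (x i) (x j) + d (x j) (x (Suc j))"
    using step by (intro d_triangle x_V) auto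
  then show ?case using step d_edge[OF x_edge[of j]] by simp
qed

lemma x_dist_mono: "\<lbrakk>i \<le> j; j \<le> Suc p\<rbrakk> \<Longrightarrow> d (x i) (x j) = j - i"
proof -
  assume ij: "i \<le> j" "j \<le> Suc p"
  have "Suc p = d (x 0) (x (Suc p))" by (simp add: x_ends)
  also have "\<dots> \<le> d (x 0) (x i) + d (x i) (x (Suc p))"
    using ij by (intro d_triangle x_V) auto
  also have "\<dots> \<le> d (x 0) (x i) + (d (x i) (x j) + d (x j) (x (Suc p)))"
    using ij by (intro add_left_mono d_triangle x_V) auto
  also have "\<dots> \<le> i + (d (x i) (x j) + (Suc p - j))"
    using ij x_dist_le[of 0 i] x_dist_le[of j "Suc p"] by simp
  finally show ?thesis using ij x_dist_le[of i j] by linarith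
qed

lemma x_dist: "\<lbrakk>i \<le> Suc p; j \<le> Suc p\<rbrakk> \<Longrightarrow> d (x i) (x j) = gap i j"
  using x_dist_mono[of i j] x_dist_mono[of j i] d_sym[OF x_V[of i] x_V[of j]]
  by (cases "i \<le> j") (auto simp: gap_def)

lemma inj_x: "inj_on x {..Suc p}"
proof (rule inj_onI)
  fix i j assume ij: "i \<in> {..Suc p}" "j \<in> {..Suc p}" "x i = x j"
  then have "gap i j = 0" using x_dist[of i j] x_V[of j] by auto
  then show "i = j" by (simp add: gap_def)
qed

lemma inj_x_spine: "inj_on x {1..p}"
  by (rule inj_on_subset[OF inj_x]) auto

lemma card_spine: "card spine = p"
  using inj_x_spine by (simp add: card_image)

lemma spine_inner: "spine \<subseteq> inner"
proof
  fix v assume "v \<in> spine"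
  then obtain i where i: "v = x i" "1 \<le> i" "i \<le> p" by auto
  have "x (i - 1) \<noteq> x (Suc i)" using inj_onD[OF inj_x, of "i - 1" "Suc i"] i by fastforce
  then show "v \<in> inner"
    using innerI[of "x i" "x (i - 1)" "x (Suc i)"] edge_sym[OF x_edge[of "i - 1"]] x_edge[of i] i
    by simp
qed

lemma spine_nonempty: "spine \<noteq> {}"
  using p_pos by simp

lemma inner_nonempty: "inner \<noteq> {}"
  using spine_inner spine_nonempty by blast

lemma geo_closed_spine: "geo_closed spine"
  unfolding geo_closed_def
proof (intro conjI ballI impI)
  show "spine \<subseteq> V" using x_V by auto
  fix u w assume uw: "u \<in> spine" "w \<in> spine" "u \<noteq> w"
  then obtain i j where ij: "u = x i" "w = x j" "1 \<le> i" "i \<le> p" "1 \<le> j" "j \<le> p"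
    by auto
  then have "i \<noteq> j" using uw by auto
  note ij = ij this
  show "\<exists>v\<in>spine. (u, v) \<in> E \<and> d u w = Suc (d v w)"
  proof (cases "i < j")
    case True
    then show ?thesis
      using ij x_edge[of i] x_dist by (intro bexI[of _ "x (Suc i)"]) (auto simp: gap_def)
  next
    case False
    then have "x (i - 1) \<in> spine" using ij by (intro imageI) auto
    then show ?thesis
      using False ij edge_sym[OF x_edge[of "i - 1"]] x_dist
      by (intro bexI[of _ "x (i - 1)"]) (auto simp: gap_def)
  qed
qed

lemma ecc_le_diam: "v \<in> V \<Longrightarrow> ecc v \<le> Suc p"
  by (intro ecc_leI diam)

text \<open>Of two neighbours of \<open>v\<close> one is farther from \<open>w\<close> than
  \<open>v\<close>, and the diameter bounds its distance.\<close>

lemma ecc_inner_le: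
  assumes "v \<in> inner"
  shows "ecc v \<le> p"
proof (rule ecc_leI)
  show v: "v \<in> V" using assms by (simp add: inner_def)
  fix w assume w: "w \<in> V"
  show "d v w \<le> p"
  proof (cases "w = v")
    case False
    then obtain b c where bc: "(v, b) \<in> E" "(v, c) \<in> E" "b \<noteq> c"
      using inner_two_nbrs[OF assms w] by blast
    have "d c w = Suc (d v w) \<or> d b w = Suc (d v w)"
      using farther_nbr[OF bc w] d_edge_cases[OF bc(1) w] by (metis lessI)
    then show ?thesis using diam[of c w] diam[of b w] bc edge_V w by auto
  qed (use v in simp)
qed

text \<open>\<open>x j\<close> is already the one neighbour of \<open>x (Suc j)\<close> nearer to
  \<open>w\<close>, so the next vertex is farther.\<close>

lemma x_dist_up_step:
  assumes "w \<in> V" "j < p" "d (x j) w < d (x (Suc j)) w"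
  shows "d (x (Suc j)) w < d (x (Suc (Suc j))) w"
proof -
  have "x j \<noteq> x (Suc (Suc j))" using inj_onD[OF inj_x, of j "Suc (Suc j)"] assms by auto
  then show ?thesis
    using farther_nbr[OF edge_sym[OF x_edge[of j]] x_edge[of "Suc j"]] assms by simp
qed

lemma x_dist_up:
  assumes w: "w \<in> V" and "i \<le> p" "d (x i) w < d (x (Suc i)) w" "i \<le> j" "j \<le> p"
  shows "d (x j) w < d (x (Suc j)) w \<and> d (x j) w = d (x i) w + (j - i)"
  using assms(4,5)
proof (induction j rule: dec_induct)
  case base
  then show ?case using assms by simp
next
  case (step j)
  have "d (x (Suc j)) w = Suc (d (x j) w)"
    using step d_edge_cases[OF x_edge[of j] w] by (metis Suc_leD Suc_lessD lessI not_less_iff_gr_or_eq)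
  then show ?case using step x_dist_up_step[OF w, of j] by simp
qed

lemma x_dist_down:
  assumes w: "w \<in> V" and "i \<le> p" "d (x (Suc i)) w < d (x i) w" "j \<le> i"
  shows "d (x (Suc (i - j))) w < d (x (i - j)) w \<and> d (x (i - j)) w = d (x i) w + j"
  using assms(4)
proof (induction j)
  case 0
  then show ?case using assms by simp
next
  case (Suc j)
  let ?m = "i - Suc j"
  have m: "i - j = Suc ?m" "?m \<le> p" using Suc.prems assms by auto
  have "d (x ?m) w = Suc (d (x (Suc ?m)) w)"
  proof (rule d_edge_cases[OF x_edge[OF m(2)] w])
    assume "d (x (Suc ?m)) w = Suc (d (x ?m) w)"
    \<comment> \<open>A rise at \<open>?m\<close> would continue, against the descent known from the
      induction hypothesis.\<close>
    then have "d (x (Suc ?m)) w < d (x (Suc (Suc ?m))) w"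
      using m Suc.prems assms by (intro x_dist_up_step) auto
    then show ?thesis using Suc m by simp
  qed
  then show ?case using Suc m by simp
qed

text \<open>Seen from any vertex, the distance along the path first decreases and then increases,
  so one of the two ends is reached by moving away from that vertex.\<close>

lemma x_dist_bound:
  assumes w: "w \<in> V" and i: "1 \<le> i" "i \<le> p"
  shows "d (x i) w \<le> max i (p + 1 - i)"
proof (rule d_edge_cases[OF x_edge[OF i(2)] w])
  assume "d (x (Suc i)) w = Suc (d (x i) w)"
  then have "d (x p) w < d (x (Suc p)) w" "d (x p) w = d (x i) w + (p - i)"
    using x_dist_up[OF w i(2), of p] i by auto
  moreover have "d (x (Suc p)) w \<le> Suc p" using diam x_V w by simp
  ultimately show ?thesis using i by simp
next
  assume "d (x i) w = Suc (d (x (Suc i)) w)"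
  then have "d (x 0) w = d (x i) w + i" using x_dist_down[OF w i(2), of i] by simp
  moreover have "d (x 0) w \<le> Suc p" using diam x_V w by simp
  ultimately show ?thesis by simp
qed

text \<open>So the path vertices have the eccentricities of the comparison spine, whatever else is
  attached to them.\<close>

lemma ecc_x:
  assumes "1 \<le> i" "i \<le> p"
  shows "ecc (x i) = max i (p + 1 - i)"
proof (rule antisym)
  show "ecc (x i) \<le> max i (p + 1 - i)"
    using assms x_V x_dist_bound by (intro ecc_leI) auto
  show "max i (p + 1 - i) \<le> ecc (x i)"
    using d_le_ecc[of "x 0" "x i"] d_le_ecc[of "x (Suc p)" "x i"] x_dist[of i 0] x_dist[of i "Suc p"]
      x_V assms by (simp add: gap_def)
qed

end

section \<open>The upper bound\<close>

context tree_metric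
begin

lemma edge_iff: "\<lbrakk>u \<in> V; v \<in> V\<rbrakk> \<Longrightarrow> (u, v) \<in> E \<longleftrightarrow> d u v = 1"
proof
  assume uv: "u \<in> V" "v \<in> V" "d u v = 1"
  then have "u \<noteq> v" by auto
  then obtain y where "(u, y) \<in> E" "d u v = Suc (d y v)" using nearer_nbr uv by metis
  then show "(u, v) \<in> E" using d_eq_0[of y v] uv edge_V by auto
qed (rule d_edge)

lemma finite_lvs: "finite lvs"
  using finite_V by (simp add: lvs_def)

lemma sum_V: "sum g V = sum g lvs + sum g inner"
proof -
  have "V = lvs \<union> inner" "lvs \<inter> inner = {}" by (auto simp: inner_def lvs_def)
  then show ?thesis using sum.union_disjoint[of lvs inner g] finite_V by (metis finite_Un)
qed

end

context diametral_tree
begin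

abbreviation xi :: nat where
  "xi \<equiv> \<Sum>v\<in>V. ecc v * (\<Sum>u\<in>V. d v u)"

lemma p_le_card_inner: "p \<le> card inner"
  using card_mono[OF geo_closed_finite[OF geo_closed_inner] spine_inner] by (simp only: card_spine)

text \<open>The weight is the eccentricity in the whole tree: \<open>ecc_x\<close> gives it on the
  spine, and off the spine \<open>ecc_inner_le\<close> suffices.\<close>

lemma inner_sums:
  "(\<forall>u\<in>inner. (\<Sum>w\<in>inner. ecc w * Suc (d u w)) \<le> path_end_sum (card inner)) \<and>
   (\<Sum>w\<in>inner. ecc w * (\<Sum>u\<in>inner. d w u)) \<le> path_inner_sum (card inner) \<and>
   (spine \<noteq> inner \<longrightarrow> (\<Sum>w\<in>inner. ecc w * (\<Sum>u\<in>inner. d w u)) < path_inner_sum (card inner))"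
proof (rule weighted_growth[OF geo_closed_inner geo_closed_spine spine_inner spine_nonempty])
  show "ecc w \<le> card spine" if "w \<in> inner" for w
    using ecc_inner_le[OF that] by (simp only: card_spine)
  have reindex: "sum g spine = (\<Sum>i = 1..p. g (x i))" for g :: "'a \<Rightarrow> nat"
    using sum.reindex[OF inj_x_spine, of g] by simp
  show "(\<Sum>w\<in>spine. ecc w) \<le> path_ecc_sum (card spine)"
    unfolding reindex card_spine path_ecc_sum_def by (rule sum_mono) (simp add: ecc_x)
  show "(\<Sum>w\<in>spine. ecc w * Suc (d u w)) \<le> path_end_sum (card spine)" if u: "u \<in> spine" for u
  proof -
    obtain j where j: "u = x j" "1 \<le> j" "j \<le> p" using u by auto
    have "(\<Sum>i = 1..p. ecc (x i) * Suc (d (x j) (x i))) = (\<Sum>i = 1..p. max i (p + 1 - i) * Suc (gap j i))"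
      using j by (intro sum.cong) (auto simp: ecc_x x_dist)
    then show ?thesis
      unfolding reindex card_spine j(1) using path_vertex_sum_le[OF j(2,3)] by simp
  qed
  have "(\<Sum>i = 1..p. ecc (x i) * (\<Sum>j = 1..p. d (x i) (x j))) = path_inner_sum p"
    unfolding path_inner_sum_def by (intro sum.cong refl) (simp add: ecc_x x_dist)
  then show "(\<Sum>w\<in>spine. ecc w * (\<Sum>u\<in>spine. d w u)) \<le> path_inner_sum (card spine)"
    unfolding reindex card_spine by simp
qed

lemma xi_bound:
  assumes ne: "lvs \<noteq> {}"
  shows "xi \<le> broom_value (card inner) (card lvs)"
    and "xi = broom_value (card inner) (card lvs) \<Longrightarrow>
      spine = inner \<and> (\<forall>v\<in>lvs. ecc v = Suc p) \<and>
      (\<Sum>u\<in>lvs. \<Sum>v\<in>lvs. d (nbr u) (nbr v))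
        = 2 * (card inner - 1) * ((card lvs div 2) * ((card lvs + 1) div 2))"
proof -
  let ?l = "card inner" and ?k = "card lvs"
  define W where "W = (\<Sum>u\<in>lvs. \<Sum>v\<in>lvs. d (nbr u) (nbr v))"
  define q where "q = (?k div 2) * ((?k + 1) div 2)"
  define Y where "Y = 2 * (?k * (?k - 1)) + 2 * (?l - 1) * q + ?k * \<Sum>{1..?l}"
  define D where "D v = (\<Sum>u\<in>V. d v u)" for v
  define A where "A = (\<Sum>v\<in>lvs. ecc v * D v)"
  define B where "B = (\<Sum>v\<in>inner. ecc v * (\<Sum>u\<in>lvs. d v u))"
  define C where "C = (\<Sum>v\<in>inner. ecc v * (\<Sum>u\<in>inner. d v u))"
  have ne': "inner \<noteq> {}" by (rule inner_nonempty)
  have leaf_V: "v \<in> V" if "v \<in> lvs" for v using that by (simp add: lvs_def)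
  have inner_V: "v \<in> V" if "v \<in> inner" for v using that by (simp add: inner_def)
  have leaf_inner: "d v w = Suc (d (nbr v) w)" if "v \<in> lvs" "w \<in> inner" for v w
    using that by (intro d_leaf) (auto simp: inner_def)
  have nbr: "nbr v \<in> inner" if "v \<in> lvs" for v using nbr_inner[OF that ne'] .
  have xi_eq: "xi = A + (B + C)"
    unfolding A_def B_def C_def D_def
    by (simp add: sum_V add_mult_distrib2 sum.distrib)
  have W: "W \<le> 2 * (?l - 1) * q"
    unfolding W_def q_def
    using sum_dist_image_le[OF geo_closed_inner finite_lvs _ ne, of nbr] nbr by blast
  have inner_part: "(\<Sum>v\<in>lvs. \<Sum>u\<in>inner. d v u) \<le> ?k * \<Sum>{1..?l}"
  proof (rule order_trans[OF sum_bounded_above])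
    show "(\<Sum>u\<in>inner. d v u) \<le> \<Sum>{1..?l}" if v: "v \<in> lvs" for v
      using sum_dist_le[OF geo_closed_inner nbr[OF v]] leaf_inner[OF v] by simp
  qed simp
  have sum_D: "(\<Sum>v\<in>lvs. D v)
      = 2 * (?k * (?k - 1)) + W + (\<Sum>v\<in>lvs. \<Sum>u\<in>inner. d v u)"
    unfolding D_def sum_V sum.distrib W_def sum_leaf_leaf[OF ne'] ..
  have D_le: "(\<Sum>v\<in>lvs. D v) \<le> Y"
    unfolding sum_D Y_def using W inner_part by simp
  have ecc_leaf: "ecc v \<le> ?l + 1" if "v \<in> lvs" for v
    using ecc_le_diam[OF leaf_V[OF that]] p_le_card_inner by simp
  have A_le: "A \<le> (?l + 1) * (\<Sum>v\<in>lvs. D v)"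
    unfolding A_def sum_distrib_left by (intro sum_mono mult_le_mono1 ecc_leaf)
  also have "\<dots> \<le> (?l + 1) * Y" using D_le by (rule mult_le_mono2)
  finally have A: "A \<le> (?l + 1) * Y" .
  \<comment> \<open>Grouped by leaves, each inner sum is a weighted distance sum from
    \<open>nbr u\<close>, which \<open>inner_sums\<close> bounds by
    \<open>path_end_sum\<close>.\<close>
  have "B = (\<Sum>u\<in>lvs. \<Sum>v\<in>inner. ecc v * Suc (d (nbr u) v))"
  proof -
    have "B = (\<Sum>v\<in>inner. \<Sum>u\<in>lvs. ecc v * d u v)"
      unfolding B_def sum_distrib_left
      using leaf_V inner_V d_sym by (intro sum.cong refl) auto
    also have "\<dots> = (\<Sum>u\<in>lvs. \<Sum>v\<in>inner. ecc v * d u v)" by (rule sum.swap)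
    finally show ?thesis using leaf_inner by simp
  qed
  also have "\<dots> \<le> ?k * path_end_sum ?l"
    using sum_bounded_above[of lvs "\<lambda>u. \<Sum>v\<in>inner. ecc v * Suc (d (nbr u) v)" "path_end_sum ?l"]
      inner_sums nbr by auto
  finally have B: "B \<le> ?k * path_end_sum ?l" .
  have C: "C \<le> path_inner_sum ?l" "spine \<noteq> inner \<Longrightarrow> C < path_inner_sum ?l"
    unfolding C_def using inner_sums by blast+
  have val: "broom_value ?l ?k = (?l + 1) * Y + (?k * path_end_sum ?l + path_inner_sum ?l)"
    by (simp add: broom_value_def Y_def q_def)
  show "xi \<le> broom_value ?l ?k"
    unfolding xi_eq val using A B C(1) by linarith
  assume "xi = broom_value ?l ?k"
  \<comment> \<open>The three estimates add up to the bound, so all of them are tight.\<close>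
  then have eq: "A = (?l + 1) * Y" "\<not> C < path_inner_sum ?l"
    unfolding xi_eq val using A B C(1) by linarith+
  have spine: "spine = inner" using eq C(2) by blast
  then have pl: "p = ?l" using card_spine by simp
  have "(?l + 1) * Y \<le> (?l + 1) * (\<Sum>v\<in>lvs. D v)" using A_le unfolding eq .
  then have "Y \<le> (\<Sum>v\<in>lvs. D v)" by (simp only: mult_le_cancel1)
  then have Y: "(\<Sum>v\<in>lvs. D v) = Y" using D_le by simp
  then have "W = 2 * (?l - 1) * q"
    using W inner_part unfolding sum_D Y_def by linarith
  moreover have "ecc v = Suc p" if v: "v \<in> lvs" for v
  proof (rule ccontr)
    assume "ecc v \<noteq> Suc p"
    then have lt: "ecc v < ?l + 1" using ecc_leaf[OF v] pl by simp
    \<comment> \<open>A positive \<open>D v\<close> is what turns a smaller eccentricity into a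
      smaller product; \<open>x 1\<close> is inner and so differs from the leaf
      \<open>v\<close>.\<close>
    have "D v \<ge> d v (x 1)"
      unfolding D_def using x_V finite_V p_pos by (intro member_le_sum) auto
    moreover have "d v (x 1) > 0"
      using leaf_inner[OF v, of "x 1"] spine_inner p_pos by fastforce
    ultimately have "0 < D v" by simp
    with lt have "ecc v * D v < (?l + 1) * D v" by (rule mult_less_mono1)
    then have "A < (\<Sum>v\<in>lvs. (?l + 1) * D v)"
      unfolding A_def using v
      by (intro sum_strict_mono_ex1 finite_lvs ballI mult_le_mono1 ecc_leaf bexI[of _ v])
    then show False unfolding sum_distrib_left[symmetric] Y eq(1) by simp
  qed
  ultimately show "spine = inner \<and> (\<forall>v\<in>lvs. ecc v = Suc p) \<and>
      (\<Sum>u\<in>lvs. \<Sum>v\<in>lvs. d (nbr u) (nbr v)) = 2 * (?l - 1) * ((?k div 2) * ((?k + 1) div 2))"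
    using spine by (simp add: W_def q_def)
qed

text \<open>A leaf at \<open>x j\<close> has eccentricity at most one more than
  \<open>max j (p + 1 - j)\<close>, which reaches \<open>p\<close> only for \<open>j = 1\<close> and
  \<open>j = p\<close>.\<close>

lemma leaf_at_end:
  assumes "spine = inner" and v: "v \<in> lvs" and "ecc v = Suc p"
  shows "nbr v = x 1 \<or> nbr v = x p"
proof -
  have "nbr v \<in> spine" using nbr_inner[OF v inner_nonempty] assms by simp
  then obtain j where j: "nbr v = x j" "1 \<le> j" "j \<le> p" by auto
  have vV: "v \<in> V" using v by (simp add: lvs_def)
  have "ecc v \<le> Suc (max j (p + 1 - j))"
  proof (rule ecc_leI[OF vV])
    fix w assume w: "w \<in> V"
    show "d v w \<le> Suc (max j (p + 1 - j))"
    proof (cases "w = v")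
      case False
      then show ?thesis using d_leaf[OF v w] x_dist_bound[OF w j(2,3)] j(1) by simp
    qed (use vV in simp)
  qed
  then have "j = 1 \<or> j = p" using assms(3) j by (auto simp: max_def split: if_splits)
  then show ?thesis using j by auto
qed

text \<open>Only pairs of leaves at different ends count, each in both orders;
  \<open>2 \<le> p\<close> keeps the ends distinct.\<close>

lemma sum_nbr_ends:
  assumes ends: "\<And>v. v \<in> lvs \<Longrightarrow> nbr v = x 1 \<or> nbr v = x p" and "2 \<le> p"
  shows "(\<Sum>u\<in>lvs. \<Sum>v\<in>lvs. d (nbr u) (nbr v))
      = 2 * (p - 1) * (card {v \<in> lvs. nbr v = x 1} * card {v \<in> lvs. nbr v = x p})"
proof -
  let ?A = "{v \<in> lvs. nbr v = x 1}" and ?B = "{v \<in> lvs. nbr v = x p}"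
  have ne: "x 1 \<noteq> x p" using inj_onD[OF inj_x, of 1 p] assms by auto
  have split: "sum g lvs = sum g ?A + sum g ?B" for g :: "'a \<Rightarrow> nat"
  proof -
    have "lvs = ?A \<union> ?B" "?A \<inter> ?B = {}" using ends ne by auto
    then show ?thesis using sum.union_disjoint[of ?A ?B g] finite_lvs by (metis finite_Un)
  qed
  have dd: "d (x 1) (x 1) = 0" "d (x p) (x p) = 0" "d (x 1) (x p) = p - 1" "d (x p) (x 1) = p - 1"
    using assms(2) by (simp_all add: x_dist gap_def)
  have row: "(\<Sum>v\<in>lvs. d y (nbr v)) = card ?A * d y (x 1) + card ?B * d y (x p)" for y
    unfolding split by simp
  have "(\<Sum>u\<in>lvs. \<Sum>v\<in>lvs. d (nbr u) (nbr v))
     = card ?A * (card ?B * (p - 1)) + card ?B * (card ?A * (p - 1))"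
    unfolding row split by (simp add: dd[unfolded One_nat_def])
  then show ?thesis by (simp add: algebra_simps)
qed

end

section \<open>Distances in trees and isomorphism invariance\<close>

lemma graph_dist_le:
  assumes "pre_digraph.awalk G u p v"
  shows "graph_dist G u v \<le> length p"
  unfolding graph_dist_def using assms by (intro cINF_lower) auto

lemma graph_dist_awalk:
  assumes "pre_digraph.awalk G u p v"
  obtains q where "pre_digraph.awalk G u q v" "length q = graph_dist G u v"
proof -
  have "graph_dist G u v \<in> length ` {p. pre_digraph.awalk G u p v}"
    unfolding graph_dist_def using assms by (intro Inf_nat_def1) auto
  then show ?thesis using that by auto
qed

text \<open>The edge condition bounds every walk from below by induction on the walk, and descending
  along \<open>nearer\<close> builds a walk of length \<open>\<delta> u w\<close>.\<close>

lemma graph_dist_eqI: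
  assumes "pair_wf_digraph G"
    and self: "\<And>w. w \<in> pverts G \<Longrightarrow> \<delta> w w = 0"
    and edge: "\<And>u v w. \<lbrakk>(u, v) \<in> parcs G; w \<in> pverts G\<rbrakk> \<Longrightarrow> \<delta> u w \<le> Suc (\<delta> v w)"
    and nearer: "\<And>u w. \<lbrakk>u \<in> pverts G; w \<in> pverts G; u \<noteq> w\<rbrakk>
        \<Longrightarrow> \<exists>v. (u, v) \<in> parcs G \<and> \<delta> u w = Suc (\<delta> v w)"
    and u: "u \<in> pverts G" and w: "w \<in> pverts G"
  shows "graph_dist G u w = \<delta> u w"
proof -
  interpret pair_wf_digraph G by fact
  have lower: "\<delta> u w \<le> length p" if "awalk u p w" for u p
    using that
  proof (induction p arbitrary: u)
    case Nil
    then show ?case using self w by (simp add: awalk_Nil_iff)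
  next
    case (Cons e es)
    then have "\<delta> (fst e) w \<le> Suc (\<delta> (snd e) w)"
      using edge[of "fst e" "snd e"] w by (simp add: awalk_Cons_iff)
    then show ?case using Cons by (fastforce simp: awalk_Cons_iff)
  qed
  have upper: "\<exists>p. awalk u p w \<and> length p = \<delta> u w"
    using u
  proof (induction "\<delta> u w" arbitrary: u)
    case 0
    then have "u = w" using nearer[of u w] w by auto
    then show ?case using 0 w by (intro exI[of _ "[]"]) (simp add: awalk_Nil_iff)
  next
    case (Suc m)
    then have "u \<noteq> w" using self w by auto
    then obtain v where v: "(u, v) \<in> parcs G" "\<delta> u w = Suc (\<delta> v w)"
      using nearer[OF Suc.prems w] by blast
    then obtain p where "awalk v p w" "length p = \<delta> v w"
      using Suc.hyps(1)[of v] Suc.hyps(2) in_arcsD2 by auto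
    then show ?case
      using v by (intro exI[of _ "(u, v) # p"]) (simp add: awalk_Cons_iff)
  qed
  then obtain p where p: "awalk u p w" "length p = \<delta> u w" by blast
  obtain q where q: "awalk u q w" "length q = graph_dist G u w"
    using graph_dist_awalk[OF p(1)] .
  have "graph_dist G u w \<le> \<delta> u w" using graph_dist_le[OF p(1)] p(2) by simp
  moreover have "\<delta> u w \<le> graph_dist G u w" using lower[OF q(1)] q(2) by simp
  ultimately show ?thesis by (rule antisym)
qed

lemma graph_dist_app_iso:
  assumes "wf_digraph G" and hom: "pre_digraph.digraph_isomorphism G hom"
    and u: "u \<in> verts G" and v: "v \<in> verts G"
  shows "graph_dist (app_iso hom G) (iso_verts hom u) (iso_verts hom v) = graph_dist G u v"
proof -
  interpret wf_digraph G by fact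
  have "length ` {p. pre_digraph.awalk (app_iso hom G) (iso_verts hom u) p (iso_verts hom v)}
      = length ` {p. awalk u p v}"
  proof (intro set_eqI iffI; elim imageE; clarify)
    fix p assume "pre_digraph.awalk (app_iso hom G) (iso_verts hom u) p (iso_verts hom v)"
    from awalk_app_isoD[OF this hom] show "length p \<in> length ` {p. awalk u p v}"
      using hom u v by (intro image_eqI[of _ _ "map (iso_arcs (inv_iso hom)) p"]) auto
  next
    fix p assume "awalk u p v"
    from awalk_app_isoI[OF this hom]
    show "length p \<in> length ` {p. pre_digraph.awalk (app_iso hom G) (iso_verts hom u) p (iso_verts hom v)}"
      by (intro image_eqI[of _ _ "map (iso_arcs hom) p"]) auto
  qed
  then show ?thesis unfolding graph_dist_def by simp
qed

lemma ecc_dist_sum_iso: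
  assumes G: "wf_digraph G" and "digraph_iso G H"
  shows "ecc_dist_sum H = ecc_dist_sum G"
proof -
  obtain hom where hom: "pre_digraph.digraph_isomorphism G hom" and H: "H = app_iso hom G"
    using assms by (auto simp: digraph_iso_def)
  let ?f = "iso_verts hom"
  note dist = graph_dist_app_iso[OF G hom]
  have inj: "inj_on ?f (verts G)"
    using hom by (rule pre_digraph.digraph_isomorphism_inj_on_verts)
  have reindex: "(\<Sum>v\<in>verts H. g v) = (\<Sum>v\<in>verts G. g (?f v))" for g :: "'c \<Rightarrow> nat"
    unfolding H verts_app_iso using sum.reindex[OF inj] by simp
  have "eccentricity H (?f v) = eccentricity G v" if "v \<in> verts G" for v
  proof -
    have "graph_dist H (?f v) ` verts H = graph_dist G v ` verts G"
      unfolding H verts_app_iso image_image using dist that by (intro image_cong) auto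
    then show ?thesis by (simp add: eccentricity_def)
  qed
  moreover have "dist_sum H (?f v) = dist_sum G v" if "v \<in> verts G" for v
    unfolding dist_sum_def reindex using dist that by (intro sum.cong) (auto simp: H)
  ultimately show ?thesis unfolding ecc_dist_sum_def reindex by simp
qed

lemma pair_digraph_isoI:
  assumes "pair_wf_digraph G"
    and f: "bij_betw f (pverts G) (pverts H)"
    and arcs: "\<And>u v. \<lbrakk>u \<in> pverts G; v \<in> pverts G\<rbrakk> \<Longrightarrow> (u, v) \<in> parcs G \<longleftrightarrow> (f u, f v) \<in> parcs H"
    and H: "pair_wf_digraph H"
  shows "digraph_iso G H"
proof -
  interpret G: pair_wf_digraph G by fact
  interpret H: pair_wf_digraph H by fact
  define hom where "hom = \<lparr>iso_verts = f, iso_arcs = map_prod f f, iso_head = snd, iso_tail = fst\<rparr>"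
  have inj: "inj_on f (pverts G)" and img: "f ` pverts G = pverts H"
    using f by (auto simp: bij_betw_def)
  have "inj_on (map_prod f f) (parcs G)"
    by (rule inj_on_subset[OF map_prod_inj_on[OF inj inj]]) (auto dest: G.in_arcsD1 G.in_arcsD2)
  then have "G.digraph_isomorphism hom"
    using inj G.wf_digraph_axioms by (auto simp: G.digraph_isomorphism_def hom_def)
  moreover have "map_prod f f ` parcs G = parcs H"
  proof (intro equalityI subsetI)
    fix e assume "e \<in> parcs H"
    moreover obtain a b where "e = (a, b)" by (cases e)
    moreover obtain u v where "u \<in> pverts G" "v \<in> pverts G" "a = f u" "b = f v"
      using calculation H.in_arcsD1 H.in_arcsD2 img by blast
    ultimately show "e \<in> map_prod f f ` parcs G" using arcs by force
  next
    fix e assume "e \<in> map_prod f f ` parcs G"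
    then obtain u v where uv: "(u, v) \<in> parcs G" "e = (f u, f v)" by auto
    then show "e \<in> parcs H" using arcs[OF G.in_arcsD1[OF uv(1)] G.in_arcsD2[OF uv(1)]] by simp
  qed
  then have "with_proj H = app_iso hom (with_proj G)"
    using img by (simp add: app_iso_def hom_def with_proj_def)
  ultimately show ?thesis unfolding digraph_iso_def by blast
qed

context pair_graph
begin

lemma dist_sym: "graph_dist G u v = graph_dist G v u"
proof -
  have len: "length (rev_path p) = length p" for p :: "('a \<times> 'a) list"
    by (induction p) auto
  have sub: "length ` {p. awalk u p v} \<subseteq> length ` {p. awalk v p u}" for u v
  proof (intro image_subsetI)
    fix p assume "p \<in> {p. awalk u p v}"
    then show "length p \<in> length ` {p. awalk v p u}"
      by (intro image_eqI[of _ _ "rev_path p"]) (simp_all add: len)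
  qed
  have "length ` {p. awalk u p v} = length ` {p. awalk v p u}"
    using sub sub by (rule subset_antisym)
  then show ?thesis by (simp add: graph_dist_def)
qed

text \<open>Shortening the walk to a path adds no arcs, so \<open>a\<close> is still avoided and the
  path closes up through \<open>a\<close>. It is nonempty since \<open>b\<close> and
  \<open>c\<close> differ, which gives at least three arcs.\<close>

lemma long_cycleI:
  assumes ab: "(a, b) \<in> parcs G" and ac: "(a, c) \<in> parcs G" and "b \<noteq> c"
    and p: "awalk b p c" "\<And>e. e \<in> set p \<Longrightarrow> fst e \<noteq> a \<and> snd e \<noteq> a"
  shows "\<exists>p. cycle p \<and> 3 \<le> length p"
proof -
  define q where "q = awalk_to_apath p"
  have q: "apath b q c" "set q \<subseteq> set p"
    unfolding q_def using apath_awalk_to_apath[OF p(1)] awalk_to_apath_subset[OF p(1)] by auto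
  then have aw: "awalk b q c" and dist: "distinct (pawalk_verts b q)" by (auto simp: apath_def)
  have "b \<noteq> a" using no_loops'[OF ab] by simp
  then have a: "a \<notin> set (pawalk_verts b q)"
    using set_awalk_verts[OF aw] p(2) q(2) by auto
  have snoc: "pawalk_verts u (r @ [(v, a)]) = pawalk_verts u r @ [a]" if "awalk u r v" for u v r
    using that by (induction r arbitrary: u) (auto simp: awalk_simps)
  have "awalk b (q @ [(c, a)]) a"
    by (rule awalk_appendI[OF aw])
      (use ac arcs_symmetric in_arcsD1 in \<open>auto simp: awalk_simps\<close>)
  then have "awalk a ((a, b) # q @ [(c, a)]) a"
    using ab by (simp add: awalk_Cons_iff del: awalk_append_iff)
  moreover have "distinct (tl (pawalk_verts a ((a, b) # q @ [(c, a)])))"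
    using dist a snoc[OF aw] by simp
  ultimately have "cycle ((a, b) # q @ [(c, a)])"
    unfolding cycle_def by (intro exI[of _ a]) simp
  moreover have "q \<noteq> []" using aw \<open>b \<noteq> c\<close> by (auto simp: awalk_Nil_iff)
  then have "3 \<le> length ((a, b) # q @ [(c, a)])" by (cases q) auto
  ultimately show ?thesis by blast
qed

lemma set_rev_path: "set (rev_path p) = prod.swap ` set p"
  by (induction p) (auto simp: image_iff)

text \<open>For a shortest walk this says that it visits only vertices nearer to \<open>w\<close>
  after its start, so it avoids any other vertex at least as far from \<open>w\<close> as its
  start.\<close>

lemma geodesic_dist:
  assumes "awalk u p w" "e \<in> set p"
  shows "(fst e = u \<or> graph_dist G (fst e) w < length p) \<and> graph_dist G (snd e) w < length p"
  using assms
proof (induction p arbitrary: u)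
  case (Cons e' es)
  then have es: "awalk (snd e') es w" "fst e' = u" by (auto simp: awalk_Cons_iff)
  have le: "graph_dist G (snd e') w \<le> length es" using graph_dist_le[OF es(1)] .
  show ?case
  proof (cases "e = e'")
    case True
    then show ?thesis using le es by simp
  next
    case False
    then have "e \<in> set es" using Cons.prems by simp
    then show ?thesis using Cons.IH[OF es(1)] le by (auto simp: less_Suc_eq_le)
  qed
qed simp

end

lemma tree_graph_metric:
  assumes "tree_graph T"
  shows "tree_metric (pverts T) (parcs T) (graph_dist T)"
proof -
  interpret pair_graph T using assms by (simp add: tree_graph_def)
  have acyclic: "\<not> (\<exists>p. cycle p \<and> 3 \<le> length p)" using assms by (simp add: tree_graph_def)
  have "strongly_connected T"
    using assms symmetric_connected_imp_strongly_connected[OF pair_sym_arcs]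
    by (simp add: tree_graph_def)
  then have conn: "\<exists>p. awalk u p v" if "u \<in> pverts T" "v \<in> pverts T" for u v
    using that by (auto simp: strongly_connected_def reachable_awalk)
  let ?d = "graph_dist T"
  have geodesic: "\<exists>p. awalk u p v \<and> length p = ?d u v" if "u \<in> pverts T" "v \<in> pverts T" for u v
    using conn[OF that] graph_dist_awalk by metis
  have zero: "?d u v = 0 \<longleftrightarrow> u = v" if uv: "u \<in> pverts T" "v \<in> pverts T" for u v
  proof
    show "u = v" if "?d u v = 0" using geodesic[OF uv] that by (auto simp: awalk_Nil_iff)
    show "?d u v = 0" if "u = v"
      using graph_dist_le[of T u "[]" v] that uv by (simp add: awalk_Nil_iff)
  qed
  have edge_le: "?d u w \<le> Suc (?d v w)" if uv: "(u, v) \<in> parcs T" "w \<in> pverts T" for u v w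
  proof -
    obtain p where "awalk v p w" "length p = ?d v w"
      using geodesic in_arcsD2[OF uv(1)] uv(2) by blast
    then show ?thesis using graph_dist_le[of T u "(u, v) # p" w] uv by (simp add: awalk_Cons_iff)
  qed
  have nearer: "\<exists>v. (u, v) \<in> parcs T \<and> ?d u w = Suc (?d v w)"
    if uw: "u \<in> pverts T" "w \<in> pverts T" "u \<noteq> w" for u w
  proof -
    obtain p where p: "awalk u p w" "length p = ?d u w" using geodesic uw by blast
    then obtain e es where e: "p = e # es" using uw by (cases p) (auto simp: awalk_Nil_iff)
    then have *: "(u, snd e) \<in> parcs T" "awalk (snd e) es w"
      using p by (auto simp: awalk_Cons_iff)
    then have "?d u w = Suc (?d (snd e) w)"
      using graph_dist_le[OF *(2)] edge_le[OF *(1) uw(2)] e p by simp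
    then show ?thesis using * by blast
  qed
  text \<open>Two neighbours of \<open>a\<close> not farther from \<open>w\<close> than \<open>a\<close> are joined through \<open>w\<close> by a walk
    avoiding \<open>a\<close>, which closes up to a cycle through \<open>a\<close>.\<close>
  have unique: "b = c"
    if E: "(a, b) \<in> parcs T" "(a, c) \<in> parcs T" and w: "w \<in> pverts T"
      and le: "?d b w \<le> ?d a w" "?d c w \<le> ?d a w" for a b c w
  proof (rule ccontr)
    assume "b \<noteq> c"
    have avoid: "fst e \<noteq> a \<and> snd e \<noteq> a"
      if "awalk y p w" "length p = ?d y w" "(a, y) \<in> parcs T" "?d y w \<le> ?d a w" "e \<in> set p" for y p e
      using geodesic_dist[OF that(1,5)] that no_loops'[OF that(3)] by auto
    obtain p where p: "awalk b p w" "length p = ?d b w" using geodesic in_arcsD2 E w by blast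
    obtain q where q: "awalk c q w" "length q = ?d c w" using geodesic in_arcsD2 E w by blast
    have "awalk b (p @ rev_path q) c" using p(1) q(1) by (intro awalk_appendI) auto
    moreover have "fst e \<noteq> a \<and> snd e \<noteq> a" if "e \<in> set (p @ rev_path q)" for e
      using that avoid[OF p E(1) le(1), of e] avoid[OF q E(2) le(2), of "prod.swap e"]
      by (auto simp: set_rev_path)
    ultimately show False
      using long_cycleI[OF E \<open>b \<noteq> c\<close>] acyclic by blast
  qed
  show ?thesis
  proof
    show "finite (pverts T)" by (rule pair_finite_verts)
    show "u \<in> pverts T \<and> v \<in> pverts T" if "(u, v) \<in> parcs T" for u v
      using that in_arcsD1 in_arcsD2 by blast
    show "(v, u) \<in> parcs T" if "(u, v) \<in> parcs T" for u v
      using that by (rule arcs_symmetric)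
    show "?d u v = ?d v u" for u v by (rule dist_sym)
    show "?d u w \<noteq> ?d v w" if uv: "(u, v) \<in> parcs T" and w: "w \<in> pverts T" for u v w
    proof
      assume eq: "?d u w = ?d v w"
      have V: "u \<in> pverts T" "v \<in> pverts T" using uv in_arcsD1 in_arcsD2 by auto
      have "u \<noteq> w" using eq zero[of u w] zero[of v w] V w no_loops'[OF uv] by auto
      then obtain y where "(u, y) \<in> parcs T" "?d u w = Suc (?d y w)" using nearer V w by blast
      \<comment> \<open>Neither \<open>v\<close> nor \<open>y\<close> is farther from
        \<open>w\<close> than \<open>u\<close>, so they coincide; this is why \<open>unique\<close>
        admits equal distances.\<close>
      then show False using unique[OF uv, of y w] eq w by auto
    qed
    show "b = c" if "(a, b) \<in> parcs T" "(a, c) \<in> parcs T" "w \<in> pverts T"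
      "?d b w < ?d a w" "?d c w < ?d a w" for a b c w
      using that unique by simp
  qed (fact zero edge_le nearer)+
qed

section \<open>The extremal tree\<close>

lemma in_symcl: "(u, v) \<in> A\<^sup>s \<longleftrightarrow> (u, v) \<in> A \<or> (v, u) \<in> A"
  by (auto simp: symcl_def)

lemma parcs_path_pendant [simp]:
  "(Spine i, Spine j) \<in> parcs (path_pendant l a b) \<longleftrightarrow> i \<in> {1..l} \<and> j \<in> {1..l} \<and> gap i j = 1"
  "(Spine i, PendantL m) \<in> parcs (path_pendant l a b) \<longleftrightarrow> i = 1 \<and> m \<in> {1..a}"
  "(PendantL m, Spine i) \<in> parcs (path_pendant l a b) \<longleftrightarrow> i = 1 \<and> m \<in> {1..a}"
  "(Spine i, PendantR r) \<in> parcs (path_pendant l a b) \<longleftrightarrow> i = l \<and> r \<in> {1..b}"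
  "(PendantR r, Spine i) \<in> parcs (path_pendant l a b) \<longleftrightarrow> i = l \<and> r \<in> {1..b}"
  "(PendantL m, PendantL m') \<notin> parcs (path_pendant l a b)"
  "(PendantL m, PendantR r) \<notin> parcs (path_pendant l a b)"
  "(PendantR r, PendantL m) \<notin> parcs (path_pendant l a b)"
  "(PendantR r, PendantR r') \<notin> parcs (path_pendant l a b)"
  unfolding path_pendant_def pair_pre_digraph.simps in_symcl by (auto simp: gap_def)

lemma pverts_path_pendant [simp]:
  "pverts (path_pendant l a b) = Spine ` {1..l} \<union> PendantL ` {1..a} \<union> PendantR ` {1..b}"
  by (simp add: path_pendant_def)

lemma path_pendant_wf:
  assumes "1 \<le> l"
  shows "pair_wf_digraph (path_pendant l a b)"
proof
  fix e assume "e \<in> parcs (path_pendant l a b)"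
  moreover obtain u v where "e = (u, v)" by (cases e)
  ultimately show "fst e \<in> pverts (path_pendant l a b)" "snd e \<in> pverts (path_pendant l a b)"
    using assms by (cases u; cases v; auto)+
qed

fun pl_pos :: "nat \<Rightarrow> pl_vertex \<Rightarrow> nat" where
  "pl_pos l (Spine i) = i"
| "pl_pos l (PendantL m) = 0"
| "pl_pos l (PendantR r) = l + 1"

text \<open>All pendant vertices at one end share the position \<open>0\<close> or
  \<open>l + 1\<close>. The distance is the gap of positions, except between two of them at the same
  end.\<close>

definition pl_dist :: "nat \<Rightarrow> pl_vertex \<Rightarrow> pl_vertex \<Rightarrow> nat" where
  "pl_dist l u v =
     (if u = v then 0 else if pl_pos l u = pl_pos l v then 2 else gap (pl_pos l u) (pl_pos l v))"

lemma graph_dist_path_pendant: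
  assumes l: "2 \<le> l" and "u \<in> pverts (path_pendant l a b)" "w \<in> pverts (path_pendant l a b)"
  shows "graph_dist (path_pendant l a b) u w = pl_dist l u w"
proof (rule graph_dist_eqI)
  let ?P = "path_pendant l a b"
  show "pair_wf_digraph ?P" using l by (intro path_pendant_wf) simp
  show "pl_dist l w w = 0" for w by (simp add: pl_dist_def)
  show "pl_dist l u w \<le> Suc (pl_dist l v w)"
    if "(u, v) \<in> parcs ?P" "w \<in> pverts ?P" for u v w
    using that l by (cases u; cases v; cases w; auto simp: pl_dist_def gap_def split: if_splits)
  show "\<exists>v. (u, v) \<in> parcs ?P \<and> pl_dist l u w = Suc (pl_dist l v w)"
    if u: "u \<in> pverts ?P" and w: "w \<in> pverts ?P" and "u \<noteq> w" for u w
  proof (cases u)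
    case (PendantL m)
    then show ?thesis
      using that l by (intro exI[of _ "Spine 1"]) (cases w; auto simp: pl_dist_def gap_def)
  next
    case (PendantR r)
    then show ?thesis
      using that l by (intro exI[of _ "Spine l"]) (cases w; auto simp: pl_dist_def gap_def)
  next
    case (Spine i)
    show ?thesis
    \<comment> \<open>If \<open>w\<close> is adjacent, the step goes to \<open>w\<close> itself:
      beyond the ends of the spine there is no \<open>Spine\<close> vertex to step to.\<close>
    proof (cases "gap i (pl_pos l w) = 1 \<and> (u, w) \<in> parcs ?P")
      case True
      then show ?thesis
        using Spine that by (intro exI[of _ w]) (auto simp: pl_dist_def gap_def)
    next
      case False
      then show ?thesis
        using Spine that l
        by (intro exI[of _ "Spine (if i < pl_pos l w then i + 1 else i - 1)"])
          (cases w; auto simp: pl_dist_def gap_def split: if_splits)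
    qed
  qed
qed (use assms in auto)

lemma sum_pverts_path_pendant:
  "(\<Sum>v\<in>pverts (path_pendant l a b). g v)
     = (\<Sum>i = 1..l. g (Spine i)) + (\<Sum>m = 1..a. g (PendantL m)) + (\<Sum>r = 1..b. g (PendantR r))"
proof -
  have "inj Spine" "inj PendantL" "inj PendantR" by (auto intro: injI)
  then have r: "sum g (Spine ` A) = (\<Sum>i\<in>A. g (Spine i))"
      "sum g (PendantL ` A) = (\<Sum>i\<in>A. g (PendantL i))"
      "sum g (PendantR ` A) = (\<Sum>i\<in>A. g (PendantR i))" for A
    by (subst sum.reindex; auto intro: inj_on_subset)+
  show ?thesis
    unfolding pverts_path_pendant r[symmetric]
    by (subst sum.union_disjoint; (auto; fail)?)+
qed

lemma ecc_dist_sum_path_pendant: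
  assumes l: "2 \<le> l" and a: "1 \<le> a" and b: "1 \<le> b"
  shows "ecc_dist_sum (path_pendant l a b)
     = (l + 1) * (2 * ((a + b) * (a + b - 1)) + 2 * (l - 1) * (a * b) + (a + b) * \<Sum>{1..l})
       + (a + b) * path_end_sum l + path_inner_sum l"
proof -
  let ?P = "path_pendant l a b"
  let ?S = "\<Sum>{1..l}"
  note dist = graph_dist_path_pendant[OF l]
  have D: "dist_sum ?P v = (\<Sum>i = 1..l. pl_dist l v (Spine i))
      + (\<Sum>m = 1..a. pl_dist l v (PendantL m)) + (\<Sum>r = 1..b. pl_dist l v (PendantR r))"
    if "v \<in> pverts ?P" for v
    unfolding dist_sum_def with_proj_simps sum_pverts_path_pendant[symmetric]
  proof (rule sum.cong)
    fix u assume u: "u \<in> pverts ?P"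
    have "pl_dist l u v = pl_dist l v u" by (auto simp: pl_dist_def gap_def)
    then show "graph_dist ?P u v = pl_dist l v u" using dist[OF u that] by simp
  qed simp
  have sum_rev: "(\<Sum>i = 1..l. l + 1 - i) = ?S" using sum_rev_Icc[of "\<lambda>i. i" l] .
  have same: "(\<Sum>m' = 1..c. if m' = m then 0 else 2) = 2 * (c - 1)" if "m \<in> {1..c}" for m c :: nat
  proof -
    have "(\<Sum>m' = 1..c. if m' = m then 0 else 2) = (\<Sum>m'\<in>{1..c} - {m}. 2::nat)"
      using that by (subst sum.remove[of _ m]) (auto intro!: sum.cong)
    then show ?thesis using that by simp
  qed
  have D_spine: "dist_sum ?P (Spine i) = (\<Sum>j = 1..l. gap i j) + (a * i + b * (l + 1 - i))"
    if i: "i \<in> {1..l}" for i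
  proof -
    have "(\<Sum>j = 1..l. pl_dist l (Spine i) (Spine j)) = (\<Sum>j = 1..l. gap i j)"
      by (intro sum.cong) (auto simp: pl_dist_def gap_def)
    moreover have "pl_dist l (Spine i) (PendantL m) = i" "pl_dist l (Spine i) (PendantR r) = l + 1 - i"
      for m r using i by (auto simp: pl_dist_def gap_def)
    moreover have "Spine i \<in> pverts ?P" using i by simp
    ultimately show ?thesis using D[of "Spine i"] by simp
  qed
  have D_L: "dist_sum ?P (PendantL m) = ?S + 2 * (a - 1) + b * (l + 1)"
    if m: "m \<in> {1..a}" for m
  proof -
    have "(\<Sum>j = 1..l. pl_dist l (PendantL m) (Spine j)) = ?S"
      by (intro sum.cong) (auto simp: pl_dist_def gap_def)
    moreover have "(\<Sum>m' = 1..a. pl_dist l (PendantL m) (PendantL m')) = 2 * (a - 1)"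
      unfolding same[OF m, symmetric] by (intro sum.cong) (auto simp: pl_dist_def)
    moreover have "pl_dist l (PendantL m) (PendantR r) = l + 1" for r
      by (simp add: pl_dist_def gap_def)
    moreover have "PendantL m \<in> pverts ?P" using m by simp
    ultimately show ?thesis using D[of "PendantL m"] by simp
  qed
  have D_R: "dist_sum ?P (PendantR r) = ?S + a * (l + 1) + 2 * (b - 1)"
    if r: "r \<in> {1..b}" for r
  proof -
    have "(\<Sum>j = 1..l. pl_dist l (PendantR r) (Spine j)) = (\<Sum>j = 1..l. l + 1 - j)"
      by (intro sum.cong) (auto simp: pl_dist_def gap_def)
    moreover have "(\<Sum>r' = 1..b. pl_dist l (PendantR r) (PendantR r')) = 2 * (b - 1)"
      unfolding same[OF r, symmetric] by (intro sum.cong) (auto simp: pl_dist_def)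
    moreover have "pl_dist l (PendantR r) (PendantL m) = l + 1" for m
      by (simp add: pl_dist_def gap_def)
    moreover have "PendantR r \<in> pverts ?P" using r by simp
    ultimately show ?thesis using D[of "PendantR r"] sum_rev by simp
  qed
  have eccI: "eccentricity ?P v = m"
    if v: "v \<in> pverts ?P" and le: "\<And>w. w \<in> pverts ?P \<Longrightarrow> pl_dist l v w \<le> m"
      and w: "w \<in> pverts ?P" "pl_dist l v w = m" for v w m
    unfolding eccentricity_def
  proof (rule Max_eqI)
    show "m \<in> graph_dist ?P v ` verts ?P" using w dist[OF v w(1)] by force
    show "y \<le> m" if "y \<in> graph_dist ?P v ` verts ?P" for y
      using that le dist[OF v] by auto
  qed simp
  have e_L: "eccentricity ?P (PendantL m) = l + 1" if "m \<in> {1..a}" for m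
    using that l b by (intro eccI[of _ _ "PendantR 1"]) (auto simp: pl_dist_def gap_def)
  have e_R: "eccentricity ?P (PendantR r) = l + 1" if "r \<in> {1..b}" for r
    using that l a by (intro eccI[of _ _ "PendantL 1"]) (auto simp: pl_dist_def gap_def)
  have e_spine: "eccentricity ?P (Spine i) = max i (l + 1 - i)" if i: "i \<in> {1..l}" for i
  proof (rule eccI[of _ _ "if l + 1 - i \<le> i then PendantL 1 else PendantR 1"])
    show "pl_dist l (Spine i) w \<le> max i (l + 1 - i)" if "w \<in> pverts ?P" for w
      using that i by (auto simp: pl_dist_def gap_def)
  qed (use i a b in \<open>auto simp: pl_dist_def gap_def\<close>)
  have "(\<Sum>i = 1..l. eccentricity ?P (Spine i) * dist_sum ?P (Spine i))
     = (\<Sum>i = 1..l. max i (l + 1 - i) * (\<Sum>j = 1..l. gap i j)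
         + (a * (max i (l + 1 - i) * i) + b * (max i (l + 1 - i) * (l + 1 - i))))"
    by (intro sum.cong refl) (simp only: e_spine D_spine add_mult_distrib2 mult.left_commute)
  also have "\<dots> = path_inner_sum l + (a + b) * path_end_sum l"
    by (simp only: sum.distrib sum_distrib_left[symmetric] path_end_sum_rev add_mult_distrib
        flip: path_inner_sum_def path_end_sum_def)
  finally have spine: "(\<Sum>i = 1..l. eccentricity ?P (Spine i) * dist_sum ?P (Spine i))
     = path_inner_sum l + (a + b) * path_end_sum l" .
  have "ecc_dist_sum ?P = path_inner_sum l + (a + b) * path_end_sum l
      + a * ((l + 1) * (?S + 2 * (a - 1) + b * (l + 1)))
      + b * ((l + 1) * (?S + a * (l + 1) + 2 * (b - 1)))"
    unfolding ecc_dist_sum_def with_proj_simps sum_pverts_path_pendant spine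
    by (simp add: e_L e_R D_L D_R)
  also have "\<dots> = (l + 1) * (2 * ((a + b) * (a + b - 1)) + 2 * (l - 1) * (a * b) + (a + b) * ?S)
       + (a + b) * path_end_sum l + path_inner_sum l"
  proof -
    \<comment> \<open>Predecessors remove the truncated subtractions and leave a polynomial
      identity.\<close>
    obtain a' b' l' where "a = Suc a'" "b = Suc b'" "l = Suc l'"
      using a b l by (metis One_nat_def Suc_le_D Suc_1 Suc_leD)
    then show ?thesis by (simp add: algebra_simps)
  qed
  finally show ?thesis .
qed

section \<open>Existence of a diametral path and recognition of the extremal tree\<close>

context tree_metric
begin

lemma leaf_edge:
  assumes "v \<in> lvs"
  shows "(v, w) \<in> E \<longleftrightarrow> w = nbr v" and "(w, v) \<in> E \<longleftrightarrow> w = nbr v"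
proof -
  show *: "(v, w) \<in> E \<longleftrightarrow> w = nbr v"
    using nbrs_leaf[OF assms] by (metis Image_singleton_iff singleton_iff)
  show "(w, v) \<in> E \<longleftrightarrow> w = nbr v"
    using * edge_sym by blast
qed

text \<open>Two neighbours of the inner vertex \<open>v\<close> are distinct and not adjacent, so
  the diameter is at least 2, as \<open>p_pos\<close> demands.\<close>

lemma diametral_tree_exists:
  assumes v: "v \<in> inner" and w: "w \<in> V" "w \<noteq> v"
  shows "\<exists>x p. diametral_tree V E d x p"
proof -
  define D where "D = Max ((\<lambda>(a, b). d a b) ` (V \<times> V))"
  have D_ge: "d a b \<le> D" if "a \<in> V" "b \<in> V" for a b
    unfolding D_def using that finite_V by (intro Max_ge) auto
  have "D \<in> (\<lambda>(a, b). d a b) ` (V \<times> V)"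
    unfolding D_def using w finite_V by (intro Max_in) auto
  then obtain a b where ab: "a \<in> V" "b \<in> V" "d a b = D" by auto
  obtain y z where yz: "(v, y) \<in> E" "(v, z) \<in> E" "y \<noteq> z" using inner_two_nbrs[OF v w] .
  then have "y \<in> V" "z \<in> V" using edge_V by blast+
  then have "d y z \<noteq> 0" "d y z \<noteq> 1"
    using yz d_eq_0[of y z] d_edge_ne[OF yz(1), of z] d_edge[OF yz(2)] by auto
  then have D2: "2 \<le> D" using D_ge[OF \<open>y \<in> V\<close> \<open>z \<in> V\<close>] by linarith
  obtain x where "x 0 = a" "x D = b" "\<forall>i < D. (x i, x (Suc i)) \<in> E"
    using geodesic_exists[OF ab(1,2)] ab(3) by blast
  moreover have "D = Suc (D - 1)" using D2 by simp
  ultimately have "diametral_tree V E d x (D - 1)"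
    using ab D_ge D2 by unfold_locales auto
  then show ?thesis by blast
qed

end

context diametral_tree
begin

text \<open>Lets the smaller bundle of leaves be taken at index \<open>1\<close>, where
  \<open>path_pendant\<close> has its \<open>a\<close> pendant vertices.\<close>

lemma reverse: "diametral_tree V E d (\<lambda>i. x (Suc p - i)) p"
proof
  show "1 \<le> p" by (rule p_pos)
  show "(x (Suc p - i), x (Suc p - Suc i)) \<in> E" if "i \<le> p" for i
    using edge_sym[OF x_edge[of "p - i"]] that by (simp add: Suc_diff_le)
  show "d (x (Suc p - 0)) (x (Suc p - Suc p)) = Suc p"
    using x_ends d_sym[OF x_V[of 0] x_V[of "Suc p"]] by simp
qed (rule diam)

text \<open>By counting, the spine is all of \<open>inner\<close>. Any enumeration of the leaves at
  each end works: a leaf is adjacent to its \<open>nbr\<close> only, and adjacency on the spine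
  means distance 1.\<close>

lemma broom_bij:
  assumes card: "card inner = p" and p: "2 \<le> p"
    and ends: "\<And>v. v \<in> lvs \<Longrightarrow> nbr v = x 1 \<or> nbr v = x p"
    and a: "a = card {v \<in> lvs. nbr v = x 1}" and b: "b = card {v \<in> lvs. nbr v = x p}"
  shows "\<exists>f. bij_betw f (pverts (path_pendant p a b)) V \<and>
    (\<forall>u\<in>pverts (path_pendant p a b). \<forall>v\<in>pverts (path_pendant p a b).
       (u, v) \<in> parcs (path_pendant p a b) \<longleftrightarrow> (f u, f v) \<in> E)"
proof -
  let ?A = "{v \<in> lvs. nbr v = x 1}" and ?B = "{v \<in> lvs. nbr v = x p}"
  have spine: "spine = inner"
    using card_subset_eq[OF geo_closed_finite[OF geo_closed_inner] spine_inner] card card_spine by metis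
  have ne: "x 1 \<noteq> x p" using inj_onD[OF inj_x, of 1 p] p by auto
  have fin: "finite ?A" "finite ?B" using finite_lvs by auto
  obtain g where g: "bij_betw g {1..a} ?A" using ex_bij_betw_nat_finite_1[OF fin(1)] a by blast
  obtain h where h: "bij_betw h {1..b} ?B" using ex_bij_betw_nat_finite_1[OF fin(2)] b by blast
  define f where "f u = (case u of Spine i \<Rightarrow> x i | PendantL m \<Rightarrow> g m | PendantR r \<Rightarrow> h r)" for u
  have f_simps [simp]: "f (Spine i) = x i" "f (PendantL m) = g m" "f (PendantR r) = h r" for i m r
    by (simp_all add: f_def)
  have gA: "g m \<in> lvs" "nbr (g m) = x 1" if "m \<in> {1..a}" for m
    using bij_betwE[OF g] that by auto
  have hB: "h r \<in> lvs" "nbr (h r) = x p" if "r \<in> {1..b}" for r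
    using bij_betwE[OF h] that by auto
  have x_not_leaf: "x i \<notin> lvs" if "i \<in> {1..p}" for i
    using that spine by (auto simp: inner_def)
  have x_eq: "x i = x j \<longleftrightarrow> i = j" if "i \<in> {1..p}" "j \<in> {1..p}" for i j
    using inj_x_spine that by (rule inj_on_eq_iff)
  have x_edge_iff: "(x i, x j) \<in> E \<longleftrightarrow> gap i j = 1" if "i \<in> {1..p}" "j \<in> {1..p}" for i j
    using that edge_iff[of "x i" "x j"] x_V x_dist[of i j] by auto
  have "inj_on f (pverts (path_pendant p a b))"
  proof (rule inj_onI)
    fix u v
    assume u: "u \<in> pverts (path_pendant p a b)" and v: "v \<in> pverts (path_pendant p a b)"
      and eq: "f u = f v"
    show "u = v"
      using u v eq
      by (cases u; cases v)
        (auto simp: x_eq dest: inj_onD[OF bij_betw_imp_inj_on[OF g]] inj_onD[OF bij_betw_imp_inj_on[OF h]],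
          (metis x_not_leaf gA hB ne atLeastAtMost_iff One_nat_def)+)
  qed
  moreover have "f ` pverts (path_pendant p a b) = V"
  proof -
    have "f ` pverts (path_pendant p a b) = spine \<union> g ` {1..a} \<union> h ` {1..b}"
      by (simp add: image_Un image_image)
    also have "\<dots> = inner \<union> ?A \<union> ?B"
      using spine g h by (simp add: bij_betw_def)
    also have "\<dots> = V" using ends by (auto simp: inner_def lvs_def)
    finally show ?thesis .
  qed
  moreover have "(u, v) \<in> parcs (path_pendant p a b) \<longleftrightarrow> (f u, f v) \<in> E"
    if u: "u \<in> pverts (path_pendant p a b)" and v: "v \<in> pverts (path_pendant p a b)" for u v
  proof -
    have leaf_g: "(g m, w) \<in> E \<longleftrightarrow> w = x 1" "(w, g m) \<in> E \<longleftrightarrow> w = x 1" if "m \<in> {1..a}" for m w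
      using leaf_edge[OF gA(1)[OF that], of w] gA(2)[OF that] by auto
    have leaf_h: "(h r, w) \<in> E \<longleftrightarrow> w = x p" "(w, h r) \<in> E \<longleftrightarrow> w = x p" if "r \<in> {1..b}" for r w
      using leaf_edge[OF hB(1)[OF that], of w] hB(2)[OF that] by auto
    have not_x: "g m \<noteq> x i" if "m \<in> {1..a}" "i \<in> {1..p}" for m i
      using gA(1)[OF that(1)] x_not_leaf[OF that(2)] by auto
    have not_x': "h r \<noteq> x i" if "r \<in> {1..b}" "i \<in> {1..p}" for r i
      using hB(1)[OF that(1)] x_not_leaf[OF that(2)] by auto
    show ?thesis
      using u v p
      by (cases u; cases v) (simp_all add: image_iff x_edge_iff leaf_g leaf_h not_x not_x' x_eq)
  qed
  ultimately show ?thesis by (auto simp: bij_betw_def)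
qed

end

lemma balanced_halves:
  "nat \<lfloor>real k / 2\<rfloor> = k div 2" "nat \<lceil>real k / 2\<rceil> = (k + 1) div 2"
proof -
  show "nat \<lfloor>real k / 2\<rfloor> = k div 2"
    using floor_divide_of_nat_eq[of k 2, where 'a = real] by simp
  have "\<lceil>real k / 2\<rceil> = int ((k + 1) div 2)"
    by (rule ceiling_unique) (use div_mult_mod_eq[of "k + 1" 2] in linarith)+
  then show "nat \<lceil>real k / 2\<rceil> = (k + 1) div 2" by simp
qed

theorem theorem3p4:
  fixes T :: "'a pair_pre_digraph" and n k :: nat
  assumes "3 \<le> k" and "k \<le> n - 2"
    and "tree_graph T"
    and "card (pverts T) = n"
    and "card (leaves T) = k"
  shows "ecc_dist_sum T
           \<le> ecc_dist_sum (path_pendant (n - k) (nat \<lfloor>real k / 2\<rfloor>) (nat \<lceil>real k / 2\<rceil>))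
       \<and> (ecc_dist_sum T
           = ecc_dist_sum (path_pendant (n - k) (nat \<lfloor>real k / 2\<rfloor>) (nat \<lceil>real k / 2\<rceil>))
          \<longleftrightarrow> digraph_iso T (path_pendant (n - k) (nat \<lfloor>real k / 2\<rfloor>) (nat \<lceil>real k / 2\<rceil>)))"
proof -
  define a b l where "a = k div 2" and "b = (k + 1) div 2" and "l = n - k"
  let ?P = "path_pendant l a b"
  have ab: "1 \<le> a" "1 \<le> b" "a + b = k" and l: "2 \<le> l"
    using assms(1,2) by (auto simp: a_def b_def l_def)
  interpret pair_graph T using assms(3) by (simp add: tree_graph_def)
  interpret tm: tree_metric "pverts T" "parcs T" "graph_dist T"
    using assms(3) by (rule tree_graph_metric)
  have "out_degree T v = card (parcs T `` {v})" for v
  proof -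
    have "out_arcs T v = Pair v ` (parcs T `` {v})" by (auto simp: out_arcs_def)
    then show ?thesis by (simp add: out_degree_def card_image inj_on_def)
  qed
  then have lvs: "tm.lvs = leaves T" by (simp add: leaves_def tm.lvs_def)
  have card_lvs: "card tm.lvs = k" using assms(5) lvs by simp
  have "tm.lvs \<subseteq> pverts T" by (auto simp: tm.lvs_def)
  then have card_inner: "card tm.inner = l"
    using card_Diff_subset[OF tm.finite_lvs] assms(4) card_lvs by (simp add: tm.inner_def l_def)
  have ne: "tm.lvs \<noteq> {}" using card_lvs ab by auto
  have "tm.inner \<noteq> {}" using card_inner l by auto
  then obtain v w where "v \<in> tm.inner" "w \<in> tm.lvs" using ne by blast
  moreover have "w \<in> pverts T" "w \<noteq> v" using calculation by (auto simp: tm.lvs_def tm.inner_def)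
  ultimately obtain x p where "diametral_tree (pverts T) (parcs T) (graph_dist T) x p"
    using tm.diametral_tree_exists by blast
  then interpret dt: diametral_tree "pverts T" "parcs T" "graph_dist T" x p .
  have xi: "ecc_dist_sum T = dt.xi"
  proof -
    have "dist_sum T v = (\<Sum>u\<in>pverts T. graph_dist T v u)" for v
      unfolding dist_sum_def with_proj_simps by (intro sum.cong refl dist_sym)
    then show ?thesis
      by (simp only: ecc_dist_sum_def eccentricity_def tm.ecc_def with_proj_simps)
  qed
  have val: "ecc_dist_sum ?P = broom_value l k"
    using ecc_dist_sum_path_pendant[OF l ab(1,2)] ab(3)
    by (simp only: broom_value_def a_def b_def)
  have wf: "wf_digraph ?P" "wf_digraph T"
    using path_pendant_wf[of l a b] l pair_wf_digraph by (simp_all add: wf_digraph_wp_iff)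
  have iso_sym: "digraph_iso T ?P \<longleftrightarrow> digraph_iso ?P T"
    by (rule iffI[OF digraph_iso_swap[OF wf(2)] digraph_iso_swap[OF wf(1)]])
  have "digraph_iso ?P T" if "ecc_dist_sum T = ecc_dist_sum ?P"
  proof -
    have "dt.xi = broom_value (card tm.inner) (card tm.lvs)"
      using that unfolding xi val card_inner card_lvs .
    from dt.xi_bound(2)[OF ne this] have eq: "dt.spine = tm.inner" "\<And>v. v \<in> tm.lvs \<Longrightarrow> tm.ecc v = Suc p"
      "(\<Sum>u\<in>tm.lvs. \<Sum>v\<in>tm.lvs. graph_dist T (tm.nbr u) (tm.nbr v)) = 2 * (l - 1) * (a * b)"
      unfolding card_inner card_lvs a_def b_def by blast+
    have pl: "p = l" using dt.card_spine card_inner eq(1) by simp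
    have ends: "tm.nbr v = x 1 \<or> tm.nbr v = x p" if "v \<in> tm.lvs" for v
      using dt.leaf_at_end[OF eq(1) that eq(2)[OF that]] .
    define A B where "A = {v \<in> tm.lvs. tm.nbr v = x 1}" and "B = {v \<in> tm.lvs. tm.nbr v = x p}"
    have "2 * (p - 1) * (card A * card B) = 2 * (l - 1) * (a * b)"
      using dt.sum_nbr_ends[OF ends] eq(3) l pl unfolding A_def B_def by simp
    \<comment> \<open>The factor \<open>2 * (l - 1)\<close> cancels because \<open>l\<close> is at
      least 2.\<close>
    then have prod: "card A * card B = a * b" using pl l by simp
    have "x 1 \<noteq> x p" using inj_onD[OF dt.inj_x, of 1 p] l pl by auto
    then have "A \<inter> B = {}" "A \<union> B = tm.lvs" using ends by (auto simp: A_def B_def)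
    then have sum: "card A + card B = k"
      using tm.finite_lvs card_lvs card_Un_disjoint[of A B] by (metis finite_Un)
    have iso: "digraph_iso ?P T"
      if ex: "\<exists>f. bij_betw f (pverts ?P) (pverts T) \<and>
        (\<forall>u\<in>pverts ?P. \<forall>v\<in>pverts ?P. (u, v) \<in> parcs ?P \<longleftrightarrow> (f u, f v) \<in> parcs T)"
    proof -
      obtain f where f: "bij_betw f (pverts ?P) (pverts T)"
        "\<forall>u\<in>pverts ?P. \<forall>v\<in>pverts ?P. (u, v) \<in> parcs ?P \<longleftrightarrow> (f u, f v) \<in> parcs T"
        using ex by blast
      show ?thesis
        by (rule pair_digraph_isoI[OF path_pendant_wf f(1) _ pair_wf_digraph]) (use l f(2) in auto)
    qed
    show ?thesis
    \<comment> \<open>The product and the sum determine the two parts only up to order.\<close>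
    proof (cases "card A \<le> card B")
      case True
      then have "card A = a" "card B = b"
        using balanced_product_aux(2)[OF sum True] prod sum ab(3) unfolding a_def b_def by auto
      then show ?thesis
        using dt.broom_bij[of a b, OF _ _ ends] card_inner pl l iso
        unfolding A_def B_def by simp
    next
      case False
      then have BA: "card B = a" "card A = b"
        using balanced_product_aux(2)[of "card B" "card A" k] prod sum ab(3)
        unfolding a_def b_def by (auto simp: mult.commute)
      interpret rev: diametral_tree "pverts T" "parcs T" "graph_dist T" "\<lambda>i. x (Suc p - i)" p
        by (rule dt.reverse)
      have "Suc p - 1 = p" "Suc p - p = 1" by simp_all
      then have "tm.nbr v = x (Suc p - 1) \<or> tm.nbr v = x (Suc p - p)" if "v \<in> tm.lvs" for v
        using ends[OF that] by metis
      then show ?thesis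
        using rev.broom_bij[of a b] card_inner pl l iso BA
        unfolding A_def B_def by simp
    qed
  qed
  moreover have "ecc_dist_sum T = ecc_dist_sum ?P" if "digraph_iso T ?P"
    using ecc_dist_sum_iso[OF wf(2) that] by simp
  moreover have "ecc_dist_sum T \<le> ecc_dist_sum ?P"
    using dt.xi_bound(1)[OF ne] unfolding xi val card_inner card_lvs .
  ultimately show ?thesis
    unfolding balanced_halves a_def[symmetric] b_def[symmetric] l_def[symmetric] iso_sym by blast
qed

end
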